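(* Let $\mathbb{K}$ be an algebraically closed field of characteristic $0$. For $q\in\mathbb{K}\setminus\{0\}$ and $p(x)\in\mathbb{K}[x,x^{-1}]$, let $A[q,\pm;p(x)]$ denote the Ore extension of $\mathbb{K}[x,x^{-1}]$ generated by $x$, its inverse $x^{-1}$, and $y$ subject to the relation $yx = qx^{\pm 1}y + p(x)$. Then the following algebras are differentially smooth: (i) $A[1,+;p(x)]$, for every $p(x)\in\mathbb{K}[x,x^{-1}]$; (ii) $A[q,+;cx]$, for every $q\in\mathbb{K}\setminus\{0\}$ and $c\in\mathbb{K}$; (iii) $A[q,-;c(x-qx^{-1})]$, for every $q\in\mathbb{K}\setminus\{0\}$ and $c\in\mathbb{K}$.
   Context: All algebras are associative and unital over $\mathbb{K}$; "affine" means finitely generated as a $\mathbb{K}$-algebra. Ore extension. For an algebra $A$ with automorphism $\sigma$, a $\sigma$-derivation is a linear map $\delta:A\to A$ with $\delta(aa')=\delta(a)a'+\sigma(a)\delta(a')$; the Ore extension $A[y;\sigma,\delta]$ is obtained by adjoining a generator $y$ with $ya=\sigma(a)y+\delta(a)$ for all $a\in A$. The algebra $A[q,\pm;p(x)]$ is $\mathbb{K}[x,x^{-1}][y;\sigma_{q,\pm},\delta_p]$, where $\sigma_{q,\pm}(x)=qx^{\pm1}$ and $\delta_p$ is the unique $\sigma_{q,\pm}$-derivation with $\delta_p(x)=p(x)$. Differential calculus. Let $A$ be an algebra. An $n$-dimensional differential calculus over $A$ is a differential graded algebra $(\Omega A, d)$ such that (a) $\Omega A = \bigoplus_{k=0}^n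 \Omega^k A$ with $\Omega^0 A = A$ and $\Omega^n A\neq 0$; (b) as an algebra, $\Omega A$ is generated by $A$ and $d(A)$; (c) $\ker (d|_A) = \mathbb{K}\cdot 1$. The product of elements of positive degree is written $\wedge$. Volume form. The calculus admits a volume form $\omega\in\Omega^n A$ if $\Omega^n A$ is freely generated by $\omega$ as a right $A$-module; associated to a volume form are the algebra automorphism $\nu_\omega: A\to A$ with $a\omega = \omega\nu_\omega(a)$ for all $a \in A$ (so the map $\nu_\omega$ determined by this equation is an automorphism), and the right $A$-module isomorphism $\pi_\omega:\Omega^n A\to A$, $\pi_\omega(\omega a) = a$. Integrating form. Let $\mathcal{I}_k A$ be the space of right $A$-module maps $\Omega^k A\to A$. For $\varphi\in \mathcal{I}_{k+m}A$ and $\omega'\in\Omega^k A$ define $\varphi\cdot\omega'\in\mathcal{I}_m A$ by $(\varphi\cdot\omega')(\omega'') = \varphi(\omega'\wedge\omega'')$ for $\omega''\in\Omega^m A$. A volume form $\omega\in\Omega^n A$ is an integrating form if for every $k=1,\ldots,n-1$ the map $\Omega^k A\to\mathcal{I}_{n-k}A$, $\omega'\mapsto\pi_\omega\cdot\omega'$, is bijective. A calculus admitting an integrating form is called integrable. Differential smoothness. An affine algebra of Gelfand-Kirillov dimension $n$ is differentially smooth if it admits an $n$-dimensional integrable differential calculus. *)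

theory Defs
  imports
    "HOL-Algebra.Algebraic_Closure_Type"
    "HOL-Algebra.Generated_Rings"
    "HOL-Algebra.Embedded_Algebras"
    "HOL-Library.Poly_Mapping"
    "HOL-Library.Extended_Real"
    "HOL-Library.Liminf_Limsup"
    "HOL-Computational_Algebra.Polynomial"
    "HOL-Computational_Algebra.Field_as_Ring"
begin

section \<open>Algebras over a field\<close>

text \<open>The ground field is a type of class \<open>field\<close>; algebras over it are structures with a carrier.
  The locale \<open>algebra\<close> of HOL-Algebra is for commutative algebras only.\<close>

abbreviation ground :: "'k::field ring"
  where "ground \<equiv> ring_of_type_algebra"

locale assoc_algebra = ring A + module "ground :: 'k::field ring" A
  for A :: "('k::field, 'a, 'm) module_scheme" (structure) +
  assumes smult_mult_left: "\<lbrakk>a \<in> carrier A; b \<in> carrier A\<rbrakk> \<Longrightarrow> (c \<odot> a) \<otimes> b = c \<odot> (a \<otimes> b)"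
    and smult_mult_right: "\<lbrakk>a \<in> carrier A; b \<in> carrier A\<rbrakk> \<Longrightarrow> a \<otimes> (c \<odot> b) = c \<odot> (a \<otimes> b)"

definition alg_hom :: "('k, 'a, 'm) module_scheme \<Rightarrow> ('k, 'b, 'n) module_scheme \<Rightarrow> ('a \<Rightarrow> 'b) set"
  where "alg_hom A B =
    {h \<in> ring_hom A B. \<forall>c. \<forall>a\<in>carrier A. h (c \<odot>\<^bsub>A\<^esub> a) = c \<odot>\<^bsub>B\<^esub> h a}"

definition scalars :: "('k, 'a, 'm) module_scheme \<Rightarrow> 'a set"
  where "scalars A = range (\<lambda>c. c \<odot>\<^bsub>A\<^esub> \<one>\<^bsub>A\<^esub>)"

definition alg_generate :: "('k, 'a, 'm) module_scheme \<Rightarrow> 'a set \<Rightarrow> 'a set"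
  where "alg_generate A S = generate_ring A (scalars A \<union> S)"

definition affine_algebra :: "('k::field, 'a, 'm) module_scheme \<Rightarrow> bool"
  where "affine_algebra A \<longleftrightarrow>
    assoc_algebra A \<and> (\<exists>S. finite S \<and> S \<subseteq> carrier A \<and> alg_generate A S = carrier A)"

definition lin_span :: "('k::field, 'a, 'm) module_scheme \<Rightarrow> 'a set \<Rightarrow> 'a set"
  where "lin_span A S = \<Inter>{U. submodule U ground A \<and> S \<subseteq> U}"


section \<open>Gelfand-Kirillov dimension\<close>

text \<open>\<open>growth_space A V n\<close> is \<open>V\<^sup>0 + V\<^sup>1 + \<dots> + V\<^sup>n\<close> where \<open>V\<^sup>0 = \<bbbK>\<cdot>1\<close>.\<close>

definition growth_space :: "('k::field, 'a, 'm) module_scheme \<Rightarrow> 'a set \<Rightarrow> nat \<Rightarrow> 'a set"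
  where "growth_space A V n =
    lin_span A {foldr (\<otimes>\<^bsub>A\<^esub>) vs \<one>\<^bsub>A\<^esub> | vs. set vs \<subseteq> V \<and> length vs \<le> n}"

text \<open>Linear dimensions are taken over the copy \<open>scalars A\<close> of the ground field inside \<open>A\<close>.\<close>

definition GKdim :: "('k::field, 'a, 'm) module_scheme \<Rightarrow> ereal"
  where "GKdim A =
    (SUP V \<in> {V. submodule V ground A \<and> ring.finite_dimension A (scalars A) V}.
      limsup (\<lambda>n. ereal (log (real n) (real (ring.dim A (scalars A) (growth_space A V n))))))"


section \<open>Differential calculi\<close>

text \<open>The differential graded algebra \<open>\<Omega>A\<close> is given by the algebra \<open>W\<close> with homogeneous
  components \<open>gr k\<close> and differential \<open>d\<close>; the equality \<open>\<Omega>\<^sup>0A = A\<close> is rendered by an isomorphism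
  \<open>\<iota>\<close> of \<open>A\<close> onto \<open>gr 0\<close>.\<close>

locale differential_calculus = A: assoc_algebra A + W: assoc_algebra W
  for n :: nat
    and A :: "('k::field, 'a, 'm) module_scheme"
    and W :: "('k::field, 'w, 'l) module_scheme"
    and gr :: "nat \<Rightarrow> 'w set"
    and d :: "'w \<Rightarrow> 'w"
    and \<iota> :: "'a \<Rightarrow> 'w" +
  assumes component: "submodule (gr k) ground W"
    and direct_sum: "w \<in> carrier W \<Longrightarrow>
      \<exists>!u. u \<in> (\<Pi>\<^sub>E k\<in>{..n}. gr k) \<and> w = (\<Oplus>\<^bsub>W\<^esub>k\<in>{..n}. u k)"
    and component_above: "k > n \<Longrightarrow> gr k = {\<zero>\<^bsub>W\<^esub>}"
    and graded_mult: "\<lbrakk>u \<in> gr k; v \<in> gr m\<rbrakk> \<Longrightarrow> u \<otimes>\<^bsub>W\<^esub> v \<in> gr (k + m)"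
    and d_add: "\<lbrakk>u \<in> carrier W; v \<in> carrier W\<rbrakk> \<Longrightarrow> d (u \<oplus>\<^bsub>W\<^esub> v) = d u \<oplus>\<^bsub>W\<^esub> d v"
    and d_smult: "u \<in> carrier W \<Longrightarrow> d (c \<odot>\<^bsub>W\<^esub> u) = c \<odot>\<^bsub>W\<^esub> d u"
    and d_degree: "u \<in> gr k \<Longrightarrow> d u \<in> gr (Suc k)"
    and d_d: "u \<in> carrier W \<Longrightarrow> d (d u) = \<zero>\<^bsub>W\<^esub>"
    and leibniz: "\<lbrakk>u \<in> gr k; v \<in> carrier W\<rbrakk> \<Longrightarrow>
      d (u \<otimes>\<^bsub>W\<^esub> v) = d u \<otimes>\<^bsub>W\<^esub> v \<oplus>\<^bsub>W\<^esub> (- 1) ^ k \<odot>\<^bsub>W\<^esub> (u \<otimes>\<^bsub>W\<^esub> d v)"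
    and \<iota>_hom: "\<iota> \<in> alg_hom A W"
    and \<iota>_bij: "bij_betw \<iota> (carrier A) (gr 0)"
    and top_nonzero: "gr n \<noteq> {\<zero>\<^bsub>W\<^esub>}"
    and generated: "alg_generate W (gr 0 \<union> d ` gr 0) = carrier W"
    and kernel: "{a \<in> carrier A. d (\<iota> a) = \<zero>\<^bsub>W\<^esub>} = scalars A"
begin

text \<open>The right \<open>A\<close>-module maps from \<open>gr k\<close> to \<open>A\<close>, as extensional functions on \<open>gr k\<close>.\<close>

definition I_space :: "nat \<Rightarrow> ('w \<Rightarrow> 'a) set"
  where "I_space k = {f \<in> gr k \<rightarrow>\<^sub>E carrier A.
    (\<forall>u\<in>gr k. \<forall>v\<in>gr k. f (u \<oplus>\<^bsub>W\<^esub> v) = f u \<oplus>\<^bsub>A\<^esub> f v) \<and>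
    (\<forall>u\<in>gr k. \<forall>a\<in>carrier A. f (u \<otimes>\<^bsub>W\<^esub> \<iota> a) = f u \<otimes>\<^bsub>A\<^esub> a)}"

text \<open>\<open>\<phi>\<cdot>w \<in> I_space m\<close> for \<open>\<phi> \<in> I_space (k + m)\<close> and \<open>w \<in> gr k\<close>.\<close>

definition I_action :: "nat \<Rightarrow> ('w \<Rightarrow> 'a) \<Rightarrow> 'w \<Rightarrow> ('w \<Rightarrow> 'a)"
  where "I_action m \<phi> w = restrict (\<lambda>u. \<phi> (w \<otimes>\<^bsub>W\<^esub> u)) (gr m)"

text \<open>Freeness of \<open>gr n\<close> on \<open>\<omega>\<close> alone makes the map \<open>\<nu>\<close> with \<open>a \<omega> = \<omega> \<nu>(a)\<close> a well-defined
  algebra endomorphism only; that it is an automorphism is a separate requirement.\<close>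

definition volume_form :: "'w \<Rightarrow> bool"
  where "volume_form \<omega> \<longleftrightarrow>
    \<omega> \<in> gr n \<and>
    bij_betw (\<lambda>a. \<omega> \<otimes>\<^bsub>W\<^esub> \<iota> a) (carrier A) (gr n) \<and>
    (\<exists>\<nu> \<in> alg_hom A A. bij_betw \<nu> (carrier A) (carrier A) \<and>
      (\<forall>a\<in>carrier A. \<iota> a \<otimes>\<^bsub>W\<^esub> \<omega> = \<omega> \<otimes>\<^bsub>W\<^esub> \<iota> (\<nu> a)))"

definition vol_iso :: "'w \<Rightarrow> 'w \<Rightarrow> 'a"
  where "vol_iso \<omega> = restrict (the_inv_into (carrier A) (\<lambda>a. \<omega> \<otimes>\<^bsub>W\<^esub> \<iota> a)) (gr n)"

definition integrating_form :: "'w \<Rightarrow> bool"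
  where "integrating_form \<omega> \<longleftrightarrow>
    volume_form \<omega> \<and>
    (\<forall>k\<in>{1..<n}. bij_betw (I_action (n - k) (vol_iso \<omega>)) (gr k) (I_space (n - k)))"

definition integrable :: bool
  where "integrable \<longleftrightarrow> (\<exists>\<omega>. integrating_form \<omega>)"

end

text \<open>HOL cannot quantify over the type of forms. Fixing it to \<open>nat \<Rightarrow> 'a\<close> loses nothing: \<open>\<Omega>A\<close> is
  generated by \<open>A\<close> and \<open>d(A)\<close>, so its cardinality is at most that of \<open>A\<close> or countable, hence at most
  that of \<open>nat \<Rightarrow> 'a\<close> (a calculus over the zero algebra does not exist), and the calculus can be
  transported along an injection. The operations on the carrier are arbitrary.\<close>

definition differentially_smooth :: "('k::field, 'a, 'm) module_scheme \<Rightarrow> bool"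
  where "differentially_smooth A \<longleftrightarrow>
    affine_algebra A \<and>
    (\<exists>n. GKdim A = ereal (real n) \<and>
      (\<exists>(W :: ('k, nat \<Rightarrow> 'a) module) gr d \<iota>.
        differential_calculus n A W gr d \<iota> \<and> differential_calculus.integrable n A W gr \<iota>))"


section \<open>Ore extensions\<close>

text \<open>The elements of \<open>R[y; \<sigma>, \<delta>]\<close> are the formal sums \<open>\<Sum> a\<^sub>i y\<^sup>i\<close>, represented by polynomials over
  \<open>R\<close>. Left multiplication by \<open>y\<close> is forced by \<open>y a = \<sigma>(a) y + \<delta>(a)\<close>, and then so is the product.\<close>

definition ore_y_times :: "('r \<Rightarrow> 'r) \<Rightarrow> ('r \<Rightarrow> 'r) \<Rightarrow> 'r::comm_ring_1 poly \<Rightarrow> 'r poly"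
  where "ore_y_times \<sigma> \<delta> g = pCons 0 (map_poly \<sigma> g) + map_poly \<delta> g"

definition ore_mult :: "('r \<Rightarrow> 'r) \<Rightarrow> ('r \<Rightarrow> 'r) \<Rightarrow> 'r::comm_ring_1 poly \<Rightarrow> 'r poly \<Rightarrow> 'r poly"
  where "ore_mult \<sigma> \<delta> f g =
    (\<Sum>i\<le>Polynomial.degree f. Polynomial.smult (Polynomial.coeff f i) ((ore_y_times \<sigma> \<delta> ^^ i) g))"

text \<open>\<open>int \<Rightarrow>\<^sub>0 'k\<close> with its convolution product is the group algebra of the integers, that is, the
  ring of Laurent polynomials.\<close>

type_synonym 'k laurent = "int \<Rightarrow>\<^sub>0 'k"

definition lconst :: "'k::field \<Rightarrow> 'k laurent"
  where "lconst c = Poly_Mapping.single 0 c"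

definition lX :: "int \<Rightarrow> 'k::field laurent"
  where "lX i = Poly_Mapping.single i 1"

definition ore_algebra ::
  "('k laurent \<Rightarrow> 'k laurent) \<Rightarrow> ('k laurent \<Rightarrow> 'k laurent) \<Rightarrow> ('k::field, 'k laurent poly) module"
  where "ore_algebra \<sigma> \<delta> =
    \<lparr>carrier = UNIV, monoid.mult = ore_mult \<sigma> \<delta>, one = 1, zero = 0, add = (+),
     module.smult = (\<lambda>c. Polynomial.smult (lconst c))\<rparr>"

definition sigma_derivation ::
  "('k::field laurent \<Rightarrow> 'k laurent) \<Rightarrow> ('k laurent \<Rightarrow> 'k laurent) \<Rightarrow> bool"
  where "sigma_derivation \<sigma> \<delta> \<longleftrightarrow>
    (\<forall>a b. \<delta> (a + b) = \<delta> a + \<delta> b) \<and>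
    (\<forall>c a. \<delta> (lconst c * a) = lconst c * \<delta> a) \<and>
    (\<forall>a b. \<delta> (a * b) = \<delta> a * b + \<sigma> a * \<delta> b)"

text \<open>The automorphism with \<open>x \<mapsto> q x\<^sup>e\<close>, where \<open>e = 1\<close> or \<open>e = -1\<close> is the sign.\<close>

definition sigma_q :: "'k::field \<Rightarrow> int \<Rightarrow> 'k laurent \<Rightarrow> 'k laurent"
  where "sigma_q q e f =
    (\<Sum>i\<in>Poly_Mapping.keys f. lconst (Poly_Mapping.lookup f i * q powi i) * lX (e * i))"

definition delta_p :: "'k::field \<Rightarrow> int \<Rightarrow> 'k laurent \<Rightarrow> 'k laurent \<Rightarrow> 'k laurent"
  where "delta_p q e p = (THE \<delta>. sigma_derivation (sigma_q q e) \<delta> \<and> \<delta> (lX 1) = p)"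

definition A_alg :: "'k::field \<Rightarrow> int \<Rightarrow> 'k laurent \<Rightarrow> ('k, 'k laurent poly) module"
  where "A_alg q e p = ore_algebra (sigma_q q e) (delta_p q e p)"

subsection \<open>Consistency of the definitions\<close>

text \<open>The description in \<open>delta_p\<close> is a proper one, and the defining relation of the Ore extension
  holds.\<close>

lemma lX_mult: "lX i * lX j = lX (i + j)"
  by (simp add: lX_def mult_single)

lemma lX_0: "lX 0 = 1"
  by (simp add: lX_def)

lemma lconst_simps [simp]: "lconst 0 = 0" "lconst 1 = 1"
  by (simp_all add: lconst_def)

lemma lconst_add: "lconst (a + b) = lconst a + lconst b"
  by (simp add: lconst_def single_add)

lemma lconst_mult: "lconst (a * b) = lconst a * lconst b"
  by (simp add: lconst_def mult_single)

lemma lconst_lX: "lconst c * lX i = Poly_Mapping.single i c"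
  by (simp add: lconst_def lX_def mult_single)

definition lin_ext :: "(int \<Rightarrow> 'k::field laurent) \<Rightarrow> 'k laurent \<Rightarrow> 'k laurent"
  where "lin_ext D f = (\<Sum>i\<in>Poly_Mapping.keys f. lconst (Poly_Mapping.lookup f i) * D i)"

lemma lin_ext_superset:
  assumes "finite S" "Poly_Mapping.keys f \<subseteq> S"
  shows "lin_ext D f = (\<Sum>i\<in>S. lconst (Poly_Mapping.lookup f i) * D i)"
  unfolding lin_ext_def
  by (rule sum.mono_neutral_left) (use assms in \<open>auto simp: in_keys_iff\<close>)

lemma lin_ext_add: "lin_ext D (f + g) = lin_ext D f + lin_ext D g"
proof -
  let ?S = "Poly_Mapping.keys f \<union> Poly_Mapping.keys g"
  have "Poly_Mapping.keys (f + g) \<subseteq> ?S"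
    by (rule Poly_Mapping.keys_add)
  then show ?thesis
    by (simp add: lin_ext_superset[of ?S] lookup_add lconst_add distrib_right sum.distrib)
qed

lemma lin_ext_single: "lin_ext D (Poly_Mapping.single i c) = lconst c * D i"
  by (simp add: lin_ext_superset[of "{i}"])

lemma laurent_induct:
  assumes "\<And>i c. P (Poly_Mapping.single i c)" "\<And>f g. P f \<Longrightarrow> P g \<Longrightarrow> P (f + g)"
  shows "P (f :: 'k::field laurent)"
proof (induction f rule: update_induct)
  case const
  then show ?case using assms(1)[of 0 0] by simp
next
  case (update f a b)
  have "Poly_Mapping.update a b f = f + Poly_Mapping.single a b"
    by (rule poly_mapping_eqI)
      (use update in \<open>auto simp: lookup_add lookup_update lookup_single when_def in_keys_iff\<close>)
  then show ?case using assms(1)[of a b] assms(2) update by simp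
qed

lemma lin_ext_smult: "lin_ext D (lconst c * f) = lconst c * lin_ext D f"
  by (induction f rule: laurent_induct)
    (simp_all add: lin_ext_add distrib_left lin_ext_single lconst_def mult_single mult.assoc[symmetric])

lemma sigma_q_lin_ext: "sigma_q q e = lin_ext (\<lambda>i. lconst (q powi i) * lX (e * i))"
  by (simp add: fun_eq_iff sigma_q_def lin_ext_def lconst_mult mult.assoc)

lemma sigma_q_mult:
  assumes "q \<noteq> 0"
  shows "sigma_q q e (f * g) = sigma_q q e f * sigma_q q e g"
proof (induction f rule: laurent_induct)
  case (1 i c)
  show ?case
  proof (induction g rule: laurent_induct)
    case (1 j b)
    show ?case
      using assms
      by (simp add: sigma_q_lin_ext lin_ext_single mult_single lconst_mult power_int_add
          distrib_left lX_mult[symmetric] mult_ac)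
  next
    case (2 f g)
    then show ?case by (simp add: sigma_q_lin_ext lin_ext_add distrib_left)
  qed
next
  case (2 f g)
  then show ?case by (simp add: sigma_q_lin_ext lin_ext_add distrib_right)
qed

lemma sigma_q_lX: "sigma_q q e (lX 1) = lconst q * lX e"
  by (simp add: sigma_q_lin_ext lin_ext_single lX_def[of 1])

lemma sigma_q_lX_0: "sigma_q q e (lX 0) = 1"
  by (simp only: sigma_q_lin_ext lX_def[of 0] lin_ext_single) (simp add: lX_0)

lemma sigma_derivation_lin_ext:
  assumes "q \<noteq> 0"
    and "\<And>i j. D (i + j) = D i * lX j + sigma_q q e (lX i) * D j"
  shows "sigma_derivation (sigma_q q e) (lin_ext D)"
proof -
  have "lin_ext D (f * g) = lin_ext D f * g + sigma_q q e f * lin_ext D g" for f g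
  proof (induction f rule: laurent_induct)
    case (1 i c)
    show ?case
    proof (induction g rule: laurent_induct)
      case (1 j b)
      have s: "sigma_q q e (Poly_Mapping.single i c) = lconst c * sigma_q q e (lX i)"
        by (simp add: sigma_q_lin_ext lin_ext_single lX_def[of i])
      have "lin_ext D (Poly_Mapping.single i c * Poly_Mapping.single j b) =
          lconst (c * b) * (D i * lX j + sigma_q q e (lX i) * D j)"
        by (simp add: mult_single lin_ext_single assms(2))
      also have "\<dots> = lconst c * D i * (lconst b * lX j)
          + (lconst c * sigma_q q e (lX i)) * (lconst b * D j)"
        by (simp add: lconst_mult algebra_simps)
      finally show ?case
        by (simp add: s lin_ext_single lconst_lX)
    next
      case (2 f g)
      then show ?case by (simp add: lin_ext_add algebra_simps)
    qed
  next
    case (2 f g)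
    then show ?case by (simp add: sigma_q_lin_ext lin_ext_add algebra_simps)
  qed
  then show ?thesis
    by (simp add: sigma_derivation_def lin_ext_add lin_ext_smult)
qed

lemma sigma_derivation_unique:
  assumes q: "q \<noteq> 0"
    and D: "sigma_derivation (sigma_q q e) \<delta>" "sigma_derivation (sigma_q q e) \<delta>'"
    and eq: "\<delta> (lX 1) = \<delta>' (lX 1)"
  shows "\<delta> = \<delta>'"
proof -
  define \<eta> where "\<eta> f = \<delta> f - \<delta>' f" for f
  have add: "\<eta> (f + g) = \<eta> f + \<eta> g"
    and sc: "\<eta> (lconst c * f) = lconst c * \<eta> f"
    and mult: "\<eta> (f * g) = \<eta> f * g + sigma_q q e f * \<eta> g" for f g c
  proof -
    have "\<delta> (f + g) = \<delta> f + \<delta> g" "\<delta>' (f + g) = \<delta>' f + \<delta>' g"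
      "\<delta> (lconst c * f) = lconst c * \<delta> f" "\<delta>' (lconst c * f) = lconst c * \<delta>' f"
      "\<delta> (f * g) = \<delta> f * g + sigma_q q e f * \<delta> g"
      "\<delta>' (f * g) = \<delta>' f * g + sigma_q q e f * \<delta>' g"
      using D unfolding sigma_derivation_def by blast+
    then show "\<eta> (f + g) = \<eta> f + \<eta> g" "\<eta> (lconst c * f) = lconst c * \<eta> f"
      "\<eta> (f * g) = \<eta> f * g + sigma_q q e f * \<eta> g"
      unfolding \<eta>_def by (simp_all only: left_diff_distrib right_diff_distrib) (simp_all only: algebra_simps)
  qed
  have one: "\<eta> 1 = 0"
    using mult[of 1 1] sigma_q_lX_0[of q e] by (simp add: lX_0)
  have x: "\<eta> (lX 1) = 0"
    by (simp add: \<eta>_def eq)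
  have unit: "\<eta> (lX i) = 0 \<Longrightarrow> \<eta> (lX (- i)) = 0" for i
  proof -
    assume "\<eta> (lX i) = 0"
    then have "\<eta> (lX (- i)) * lX i = 0"
      using mult[of "lX (- i)" "lX i"] one by (simp add: lX_mult lX_0)
    then have "\<eta> (lX (- i)) * lX i * lX (- i) = 0"
      by simp
    then show ?thesis
      by (simp add: mult.assoc lX_mult lX_0)
  qed
  have nat: "\<eta> (lX (int n)) = 0" for n
  proof (induction n)
    case (Suc n)
    then show ?case
      using mult[of "lX 1" "lX (int n)"] x by (simp add: lX_mult)
  qed (simp add: lX_0 one)
  have lX: "\<eta> (lX i) = 0" for i
    using nat[of "nat i"] unit[OF nat[of "nat (- i)"]] by (cases "i \<ge> 0") simp_all
  have "\<eta> f = 0" for f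
    by (induction f rule: laurent_induct) (simp_all add: add sc lX flip: lconst_lX)
  then show ?thesis
    by (auto simp: \<eta>_def)
qed

lemma sigma_derivation_exists:
  assumes q: "q \<noteq> 0"
  shows "\<exists>\<delta>. sigma_derivation (sigma_q q e) \<delta> \<and> \<delta> (lX 1) = p"
proof -
  let ?s = "\<lambda>i. sigma_q q e (lX i)"
  have s_add: "?s (i + j) = ?s i * ?s j" for i j
    using sigma_q_mult[OF q, of e "lX i" "lX j"] by (simp add: lX_mult)
  have s_0: "?s 0 = 1"
    by (rule sigma_q_lX_0)
  have s_1: "sigma_q q e 1 = 1"
    using s_0 by (simp add: lX_0)
  have cocycle: "\<exists>D. D 1 = p \<and> (\<forall>i j. D (i + j) = D i * lX j + ?s i * D j)"
  proof (cases "?s 1 = lX 1")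
    case True
    have nat: "?s (int n) = lX (int n)" for n
    proof (induction n)
      case (Suc n)
      then show ?case
        using s_add[of 1 "int n"] True by (simp add: lX_mult)
    qed (simp add: s_0, simp add: lX_0)
    have neg: "?s (- int n) = lX (- int n)" for n
    proof -
      have "?s (- int n) = ?s (- int n) * (lX (int n) * lX (- int n))"
        by (simp add: lX_mult lX_0)
      also have "\<dots> = ?s (- int n + int n) * lX (- int n)"
        by (simp only: s_add nat mult.assoc)
      finally show ?thesis
        by (simp add: s_0)
    qed
    have s: "?s i = lX i" for i
      using nat[of "nat i"] neg[of "nat (- i)"] by (cases "i \<ge> 0") simp_all
    show ?thesis
    proof (intro exI[of _ "\<lambda>i. of_int i * lX (i - 1) * p"] conjI allI)
      show "of_int (i + j) * lX (i + j - 1) * p =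
          of_int i * lX (i - 1) * p * lX j + ?s i * (of_int j * lX (j - 1) * p)" for i j
      proof -
        have "of_int i * lX (i - 1) * p * lX j + ?s i * (of_int j * lX (j - 1) * p) =
            of_int i * (lX (i - 1) * lX j) * p + of_int j * (lX i * lX (j - 1)) * p"
          unfolding s by (simp only: ac_simps)
        also have "\<dots> = of_int i * lX (i + j - 1) * p + of_int j * lX (i + j - 1) * p"
          unfolding lX_mult by (simp add: algebra_simps)
        finally show ?thesis
          by (simp only: of_int_add distrib_right)
      qed
    qed (simp add: lX_0)
  next
    case False
    let ?a = "?s 1 - lX 1"
    have "\<exists>t. ?a * t = ?s i - lX i" for i
    proof -
      have nat: "\<exists>t. ?a * t = ?s (int n) - lX (int n)" for n
      proof (induction n)
        case 0
        show ?case by (intro exI[of _ 0]) (simp add: lX_0 s_1)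
      next
        case (Suc n)
        then obtain t where t: "?a * t = ?s (int n) - lX (int n)" by blast
        have "?a * (t * lX 1 + ?s (int n)) =
            ?s (int n) * ?s 1 - lX (int n) * lX 1"
          unfolding distrib_left mult.assoc[symmetric] t by (simp add: algebra_simps)
        then show ?case
          using s_add[of "int n" 1] lX_mult[of "int n" 1]
          by (intro exI[of _ "t * lX 1 + ?s (int n)"]) (simp add: add.commute)
      qed
      have neg: "\<exists>t. ?a * t = ?s (- int n) - lX (- int n)" for n
      proof -
        obtain t where t: "?a * t = ?s (int n) - lX (int n)" using nat by blast
        have "?a * (- t * ?s (- int n) * lX (- int n)) =
            - (?s (int n) - lX (int n)) * ?s (- int n) * lX (- int n)"
          by (simp flip: t add: mult.assoc)
        also have "\<dots> = ?s (- int n) * (lX (int n) * lX (- int n))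
            - (?s (int n) * ?s (- int n)) * lX (- int n)"
          by (simp add: algebra_simps)
        also have "\<dots> = ?s (- int n) - lX (- int n)"
          by (simp add: lX_mult lX_0 s_1 flip: s_add)
        finally show ?thesis by blast
      qed
      show ?thesis
        using nat[of "nat i"] neg[of "nat (- i)"] by (cases "i \<ge> 0") simp_all
    qed
    then obtain t where t: "\<And>i. ?a * t i = ?s i - lX i" by metis
    have a: "?a \<noteq> 0" using False by simp
    show ?thesis
    proof (intro exI[of _ "\<lambda>i. t i * p"] conjI allI)
      have "?a * t 1 = ?a * 1" using t[of 1] by simp
      then have "t 1 = 1" using a mult_left_cancel by blast
      then show "t 1 * p = p" by simp
      fix i j
      have "?a * t (i + j) = ?a * (t i * lX j + ?s i * t j)"
      proof -
        have "?a * (t i * lX j + ?s i * t j) = (?a * t i) * lX j + ?s i * (?a * t j)"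
          by (simp add: algebra_simps)
        then show ?thesis
          unfolding t unfolding s_add unfolding lX_mult[symmetric] by (simp add: algebra_simps)
      qed
      then have "t (i + j) = t i * lX j + ?s i * t j"
        using a mult_left_cancel by blast
      then show "t (i + j) * p = t i * p * lX j + ?s i * (t j * p)"
        by (simp add: algebra_simps)
    qed
  qed
  then obtain D where D: "D 1 = p" "\<And>i j. D (i + j) = D i * lX j + ?s i * D j" by blast
  have "lin_ext D (lX 1) = p"
    by (simp add: lX_def lin_ext_single D)
  then show ?thesis
    using sigma_derivation_lin_ext[OF q D(2)] by blast
qed

lemma delta_p:
  assumes "q \<noteq> 0"
  shows "sigma_derivation (sigma_q q e) (delta_p q e p)" "delta_p q e p (lX 1) = p"
proof -
  have "\<exists>!\<delta>. sigma_derivation (sigma_q q e) \<delta> \<and> \<delta> (lX 1) = p"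
    using sigma_derivation_exists[OF assms] sigma_derivation_unique[OF assms] by metis
  from theI'[OF this]
  show "sigma_derivation (sigma_q q e) (delta_p q e p)" "delta_p q e p (lX 1) = p"
    by (simp_all add: delta_p_def)
qed

lemma A_alg_relation:
  assumes "q \<noteq> 0"
  shows "[:0, 1:] \<otimes>\<^bsub>A_alg q e p\<^esub> [:lX 1:] = [:p, lconst q * lX e:]"
proof -
  have "delta_p q e p (lconst 0 * 0) = lconst 0 * delta_p q e p 0"
    using delta_p(1)[OF assms] unfolding sigma_derivation_def by blast
  then have "delta_p q e p 0 = 0"
    by simp
  moreover have "sigma_q q e 0 = 0"
    by (simp add: sigma_q_def)
  ultimately show ?thesis
    using delta_p(2)[OF assms, of e p]
    by (simp add: A_alg_def ore_algebra_def ore_mult_def ore_y_times_def map_poly_pCons sigma_q_lX)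
qed

end

theory Submission
  imports Defs
begin

text \<open>Let \<open>B\<close> be the ring of Laurent polynomials and \<open>D\<close> its derivation \<open>x d/dx\<close>. All the algebras in
  question are Ore extensions \<open>A = B[y; \<sigma>, \<delta>]\<close> for which \<open>D \<sigma> = \<epsilon> \<sigma> D\<close> with a sign \<open>\<epsilon> = \<plusminus>1\<close>, and
  \<open>\<delta>\<close> has one of two shapes. If \<open>\<sigma>\<close> is the identity, then \<open>\<delta> = f D\<close> with \<open>f = p x\<^sup>-\<^sup>1\<close>. In the
  other cases \<open>\<delta>\<close> is inner, \<open>\<delta>(b) = c (b - \<sigma>(b))\<close>; here \<open>c x\<close> is rewritten as
  \<open>c / (1 - q) \<cdot> (x - q x)\<close> when \<open>q \<noteq> 1\<close>.

  The calculus is the exterior algebra on \<open>\<eta> = x\<^sup>-\<^sup>1 dx\<close> and \<open>dy\<close>, free over \<open>A\<close>, with the bimodule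
  relations \<open>\<eta> a = \<rho>(a) \<eta>\<close> and \<open>dy a = \<theta>(a) dy\<close>, and \<open>dy \<and> \<eta> = - \<epsilon> \<eta> \<and> dy\<close>. The automorphism
  \<open>\<theta>\<close> is \<open>\<sigma>\<close> on \<open>B\<close> and fixes \<open>y\<close>; the automorphism \<open>\<rho>\<close> is the identity on \<open>B\<close> and maps \<open>y\<close> to
  \<open>\<epsilon> y + g\<close>, where \<open>g\<close> is \<open>- D f\<close> in the first case and \<open>(1 - \<epsilon>) c\<close> in the second; these
  choices are compatible with the relation obtained by differentiating \<open>y x = \<sigma>(x) y + \<delta>(x)\<close>. The partial derivatives in
  \<open>da = D\<^sub>\<eta>(a) \<eta> + \<partial>a/\<partial>y dy\<close> are a \<open>\<rho>\<close>-derivation and a \<open>\<theta>\<close>-derivation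
  (\<open>eta_derivation\<close>, \<open>y_derivation\<close>) that commute up to the sign
  \<open>\<epsilon>\<close> with each other and with the other automorphism, and this yields both \<open>d d = 0\<close> and the Leibniz
  rule (\<open>differential_calculus_\<Omega>\<close>). The form \<open>\<eta> \<and> dy\<close> is integrating because the wedge product
  pairs the basis \<open>\<eta>, dy\<close> of the one-forms with itself perfectly (\<open>integrating_form_volume\<close>).

  Finally \<open>A\<close> has Gelfand-Kirillov dimension 2: if \<open>y\<close> gets a weight that dominates the degree of \<open>\<delta>\<close>,
  then the monomials \<open>x\<^sup>i y\<^sup>j\<close> of bounded weight span a multiplicative filtration of quadratic growth
  (\<open>GKdim_bounded_ore\<close>).\<close>

section \<open>Algebras whose carrier is a type\<close>

locale typed_algebra = vector_space scl
  for scl :: "'k::field \<Rightarrow> 'a::ab_group_add \<Rightarrow> 'a" (infixr \<open>\<bullet>\<close> 75) +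
  fixes mul :: "'a \<Rightarrow> 'a \<Rightarrow> 'a" (infixl \<open>\<star>\<close> 70)
    and one :: 'a (\<open>\<e>\<close>)
  assumes mul_assoc: "(a \<star> b) \<star> c = a \<star> (b \<star> c)"
    and mul_add_left: "(a + b) \<star> c = a \<star> c + b \<star> c"
    and mul_add_right: "a \<star> (b + c) = a \<star> b + a \<star> c"
    and mul_scl_left: "(k \<bullet> a) \<star> b = k \<bullet> (a \<star> b)"
    and mul_scl_right: "a \<star> (k \<bullet> b) = k \<bullet> (a \<star> b)"
    and one_mul [simp]: "\<e> \<star> a = a"
    and mul_one [simp]: "a \<star> \<e> = a"
    and one_neq_zero: "\<e> \<noteq> 0"
begin

definition alg :: "('k, 'a) module"
  where "alg = \<lparr>carrier = UNIV, monoid.mult = (\<star>), one = \<e>, zero = 0, add = (+), module.smult = (\<bullet>)\<rparr>"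

lemma alg_simps [simp]:
  "carrier alg = UNIV" "a \<otimes>\<^bsub>alg\<^esub> b = a \<star> b" "\<one>\<^bsub>alg\<^esub> = \<e>" "\<zero>\<^bsub>alg\<^esub> = 0"
  "a \<oplus>\<^bsub>alg\<^esub> b = a + b" "k \<odot>\<^bsub>alg\<^esub> a = k \<bullet> a"
  by (simp_all add: alg_def)

lemma mul_zero_left [simp]: "0 \<star> a = 0"
  using mul_add_left[of 0 0 a] by simp

lemma mul_zero_right [simp]: "a \<star> 0 = 0"
  using mul_add_right[of a 0 0] by simp

lemma mul_minus_left: "(- a) \<star> b = - (a \<star> b)"
  using mul_add_left[of "- a" a b] by (simp add: eq_neg_iff_add_eq_0)

lemma mul_minus_right: "a \<star> (- b) = - (a \<star> b)"
  using mul_add_right[of a "- b" b] by (simp add: eq_neg_iff_add_eq_0)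

lemma mul_diff_left: "(a - b) \<star> c = a \<star> c - b \<star> c"
  using mul_add_left[of a "- b" c] by (simp add: mul_minus_left)

lemma mul_diff_right: "a \<star> (b - c) = a \<star> b - a \<star> c"
  using mul_add_right[of a b "- c"] by (simp add: mul_minus_right)

lemmas mul_linear = mul_add_left mul_add_right mul_minus_left mul_minus_right
  mul_diff_left mul_diff_right mul_scl_left mul_scl_right

lemmas scl_linear = scale_left_distrib scale_right_distrib scale_minus_left scale_minus_right
  scale_left_diff_distrib scale_right_diff_distrib

lemma assoc_algebra_alg: "assoc_algebra alg"
proof (intro assoc_algebra.intro module.intro)
  show "ring alg"
    by (intro ringI abelian_groupI monoidI)
      (auto simp: mul_linear mul_assoc add.assoc add.commute intro: exI[of _ "- x" for x])
  then show "abelian_group alg"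
    by (simp add: ring_def)
  show "cring (ground :: 'k ring)"
    by (rule cring_from_type_algebra)
  show "module_axioms (ground :: 'k ring) alg"
    by unfold_locales (auto simp: scl_linear ring_of_type_algebra_def)
  show "assoc_algebra_axioms alg"
    by unfold_locales (auto simp: mul_linear)
qed

end

section \<open>A two-dimensional calculus from two twisted derivations\<close>

text \<open>The form \<open>a + b \<eta> + c \<zeta> + d (\<eta> \<and> \<zeta>)\<close>, stored by its coefficients with respect to the left basis
  \<open>1, \<eta>, \<zeta>, \<eta> \<and> \<zeta>\<close>.\<close>

definition form :: "'a \<Rightarrow> 'a \<Rightarrow> 'a \<Rightarrow> 'a \<Rightarrow> nat \<Rightarrow> 'a::zero"
  where "form a b c d = (\<lambda>_. 0)(0 := a, 1 := b, 2 := c, 3 := d)"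

lemma form_nth [simp]:
  "form a b c d 0 = a" "form a b c d (Suc 0) = b" "form a b c d 2 = c" "form a b c d 3 = d"
  by (simp_all add: form_def)

lemma form_inject [simp]:
  "form a b c d = form a' b' c' d' \<longleftrightarrow> a = a' \<and> b = b' \<and> c = c' \<and> d = d'"
  by (metis form_nth)

text \<open>The algebra carries two twisted derivations, meant as the coefficients in \<open>da = D\<^sub>1(a) \<eta> + D\<^sub>2(a) \<zeta>\<close>.
  With \<open>\<eta> a = \<rho>(a) \<eta>\<close> and \<open>\<zeta> a = \<theta>(a) \<zeta>\<close> the Leibniz rule for \<open>d\<close> on \<open>A\<close> amounts to the two product
  rules. If moreover \<open>\<zeta> \<and> \<eta> = - \<epsilon> \<eta> \<and> \<zeta>\<close>, then the commutation law for \<open>D\<^sub>1\<close> and \<open>D\<^sub>2\<close> says \<open>d d = 0\<close>, and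
  the two mixed laws give the Leibniz rule for a one-form times a function. The last three assumptions
  ensure that only scalars are closed and that \<open>\<eta>\<close> and \<open>\<zeta>\<close> lie in \<open>A \<cdot> dA\<close>.\<close>

locale twisted_calculus = typed_algebra scl mul one
  for scl :: "'k::field \<Rightarrow> 'a::ab_group_add \<Rightarrow> 'a" (infixr \<open>\<bullet>\<close> 75)
    and mul :: "'a \<Rightarrow> 'a \<Rightarrow> 'a" (infixl \<open>\<star>\<close> 70)
    and one :: 'a (\<open>\<e>\<close>) +
  fixes \<rho> \<theta> D\<^sub>1 D\<^sub>2 :: "'a \<Rightarrow> 'a" and \<epsilon> :: 'k
  assumes sign: "\<epsilon> * \<epsilon> = 1"
    and \<rho>_hom: "\<rho> (a + b) = \<rho> a + \<rho> b" "\<rho> (k \<bullet> a) = k \<bullet> \<rho> a" "\<rho> (a \<star> b) = \<rho> a \<star> \<rho> b" "\<rho> \<e> = \<e>"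
    and \<theta>_hom: "\<theta> (a + b) = \<theta> a + \<theta> b" "\<theta> (k \<bullet> a) = k \<bullet> \<theta> a" "\<theta> (a \<star> b) = \<theta> a \<star> \<theta> b" "\<theta> \<e> = \<e>"
    and bij_\<rho>: "bij \<rho>" and bij_\<theta>: "bij \<theta>"
    and D\<^sub>1_linear: "D\<^sub>1 (a + b) = D\<^sub>1 a + D\<^sub>1 b" "D\<^sub>1 (k \<bullet> a) = k \<bullet> D\<^sub>1 a"
    and D\<^sub>2_linear: "D\<^sub>2 (a + b) = D\<^sub>2 a + D\<^sub>2 b" "D\<^sub>2 (k \<bullet> a) = k \<bullet> D\<^sub>2 a"
    and D\<^sub>1_mul: "D\<^sub>1 (a \<star> b) = D\<^sub>1 a \<star> \<rho> b + a \<star> D\<^sub>1 b"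
    and D\<^sub>2_mul: "D\<^sub>2 (a \<star> b) = D\<^sub>2 a \<star> \<theta> b + a \<star> D\<^sub>2 b"
    and \<rho>_\<theta>: "\<rho> (\<theta> a) = \<theta> (\<rho> a)"
    and D\<^sub>1_\<theta>: "D\<^sub>1 (\<theta> a) = \<epsilon> \<bullet> \<theta> (D\<^sub>1 a)"
    and D\<^sub>2_\<rho>: "D\<^sub>2 (\<rho> a) = \<epsilon> \<bullet> \<rho> (D\<^sub>2 a)"
    and D\<^sub>1_D\<^sub>2: "D\<^sub>1 (D\<^sub>2 a) = \<epsilon> \<bullet> D\<^sub>2 (D\<^sub>1 a)"
    and constants: "D\<^sub>1 a = 0 \<Longrightarrow> D\<^sub>2 a = 0 \<Longrightarrow> \<exists>k. a = k \<bullet> \<e>"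
    and coordinate_D\<^sub>1: "\<exists>u x. u \<star> D\<^sub>1 x = \<e> \<and> D\<^sub>2 x = 0"
    and coordinate_D\<^sub>2: "\<exists>y. D\<^sub>1 y = 0 \<and> D\<^sub>2 y = \<e>"
begin

text \<open>The associative product determined by \<open>\<eta> a = \<rho>(a) \<eta>\<close>, \<open>\<zeta> a = \<theta>(a) \<zeta>\<close>, \<open>\<eta> \<and> \<eta> = \<zeta> \<and> \<zeta> = 0\<close> and
  \<open>\<zeta> \<and> \<eta> = - \<epsilon> \<eta> \<and> \<zeta>\<close>.\<close>

definition wedge :: "(nat \<Rightarrow> 'a) \<Rightarrow> (nat \<Rightarrow> 'a) \<Rightarrow> nat \<Rightarrow> 'a"
  where "wedge u v = form
    (u 0 \<star> v 0)
    (u 0 \<star> v 1 + u 1 \<star> \<rho> (v 0))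
    (u 0 \<star> v 2 + u 2 \<star> \<theta> (v 0))
    (u 0 \<star> v 3 + u 1 \<star> \<rho> (v 2) - \<epsilon> \<bullet> (u 2 \<star> \<theta> (v 1)) + u 3 \<star> \<rho> (\<theta> (v 0)))"

definition \<Omega> :: "('k, nat \<Rightarrow> 'a) module"
  where "\<Omega> = \<lparr>carrier = {form a b c d | a b c d. True}, monoid.mult = wedge, one = form \<e> 0 0 0,
    zero = form 0 0 0 0, add = (\<lambda>u v k. u k + v k), module.smult = (\<lambda>c u k. c \<bullet> u k)\<rparr>"

definition \<Omega>_degree :: "nat \<Rightarrow> (nat \<Rightarrow> 'a) set"
  where "\<Omega>_degree k =
    (if k = 0 then {form a 0 0 0 | a. True}
     else if k = 1 then {form 0 b c 0 | b c. True}
     else if k = 2 then {form 0 0 0 d | d. True}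
     else {form 0 0 0 0})"

text \<open>In degree one this uses that \<open>\<eta>\<close> and \<open>\<zeta>\<close> are closed:
  \<open>d(b \<eta> + c \<zeta>) = db \<and> \<eta> + dc \<and> \<zeta>\<close>.\<close>

definition differential :: "(nat \<Rightarrow> 'a) \<Rightarrow> nat \<Rightarrow> 'a"
  where "differential u = form 0 (D\<^sub>1 (u 0)) (D\<^sub>2 (u 0)) (D\<^sub>1 (u 2) - \<epsilon> \<bullet> D\<^sub>2 (u 1))"

abbreviation "inclusion \<equiv> (\<lambda>a. form a 0 0 0)"

abbreviation volume :: "nat \<Rightarrow> 'a"
  where "volume \<equiv> form 0 0 0 \<e>"

lemma \<Omega>_carrier: "u \<in> carrier \<Omega> \<longleftrightarrow> (\<exists>a b c d. u = form a b c d)"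
  by (simp add: \<Omega>_def)

lemma form_carrier [simp]: "form a b c d \<in> carrier \<Omega>"
  by (auto simp: \<Omega>_carrier)

lemma \<Omega>_simps [simp]:
  "form a b c d \<otimes>\<^bsub>\<Omega>\<^esub> form a' b' c' d' = form (a \<star> a') (a \<star> b' + b \<star> \<rho> a') (a \<star> c' + c \<star> \<theta> a')
     (a \<star> d' + b \<star> \<rho> c' - \<epsilon> \<bullet> (c \<star> \<theta> b') + d \<star> \<rho> (\<theta> a'))"
  "\<one>\<^bsub>\<Omega>\<^esub> = form \<e> 0 0 0"
  "\<zero>\<^bsub>\<Omega>\<^esub> = form 0 0 0 0"
  "form a b c d \<oplus>\<^bsub>\<Omega>\<^esub> form a' b' c' d' = form (a + a') (b + b') (c + c') (d + d')"
  "k \<odot>\<^bsub>\<Omega>\<^esub> form a b c d = form (k \<bullet> a) (k \<bullet> b) (k \<bullet> c) (k \<bullet> d)"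
  by (auto simp: \<Omega>_def wedge_def form_def fun_eq_iff)

lemma differential_form [simp]:
  "differential (form a b c d) = form 0 (D\<^sub>1 a) (D\<^sub>2 a) (D\<^sub>1 c - \<epsilon> \<bullet> D\<^sub>2 b)"
  by (simp add: differential_def)

lemma form_cases:
  assumes "u \<in> carrier \<Omega>" obtains a b c d where "u = form a b c d"
  using assms by (auto simp: \<Omega>_carrier)

lemma zero_images [simp]: "\<rho> 0 = 0" "\<theta> 0 = 0" "D\<^sub>1 0 = 0" "D\<^sub>2 0 = 0"
  using \<rho>_hom(1)[of 0 0] \<theta>_hom(1)[of 0 0] D\<^sub>1_linear(1)[of 0 0] D\<^sub>2_linear(1)[of 0 0] by simp_all

lemma minus_images [simp]: "\<rho> (- a) = - \<rho> a" "\<theta> (- a) = - \<theta> a" "D\<^sub>1 (- a) = - D\<^sub>1 a" "D\<^sub>2 (- a) = - D\<^sub>2 a"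
  using \<rho>_hom(1)[of a "- a"] \<theta>_hom(1)[of a "- a"] D\<^sub>1_linear(1)[of a "- a"] D\<^sub>2_linear(1)[of a "- a"]
  by (simp_all add: eq_neg_iff_add_eq_0 add.commute)

lemma diff_images: "\<rho> (a - b) = \<rho> a - \<rho> b" "\<theta> (a - b) = \<theta> a - \<theta> b"
  "D\<^sub>1 (a - b) = D\<^sub>1 a - D\<^sub>1 b" "D\<^sub>2 (a - b) = D\<^sub>2 a - D\<^sub>2 b"
  using \<rho>_hom(1)[of a "- b"] \<theta>_hom(1)[of a "- b"] D\<^sub>1_linear(1)[of a "- b"] D\<^sub>2_linear(1)[of a "- b"]
  by simp_all

lemma one_images [simp]: "D\<^sub>1 \<e> = 0" "D\<^sub>2 \<e> = 0"
  using D\<^sub>1_mul[of \<e> \<e>] D\<^sub>2_mul[of \<e> \<e>] by (simp_all add: \<rho>_hom(4) \<theta>_hom(4))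

lemma sign_cancel: "\<epsilon> \<bullet> \<epsilon> \<bullet> a = a"
  by (simp add: sign)

lemmas form_algebra = mul_linear scl_linear mul_assoc \<rho>_hom \<theta>_hom diff_images D\<^sub>1_linear D\<^sub>2_linear
  D\<^sub>1_mul D\<^sub>2_mul D\<^sub>1_\<theta> D\<^sub>2_\<rho> D\<^sub>1_D\<^sub>2 \<rho>_\<theta> sign

lemma assoc_algebra_\<Omega>: "assoc_algebra \<Omega>"
proof (intro assoc_algebra.intro module.intro)
  show ring: "ring \<Omega>"
  proof (intro ringI abelian_groupI monoidI)
    fix u assume "u \<in> carrier \<Omega>"
    then obtain a b c d where "u = form a b c d" by (rule form_cases)
    then show "\<exists>v\<in>carrier \<Omega>. v \<oplus>\<^bsub>\<Omega>\<^esub> u = \<zero>\<^bsub>\<Omega>\<^esub>"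
      by (intro bexI[of _ "form (- a) (- b) (- c) (- d)"]) simp_all
  qed (auto elim!: form_cases simp: form_algebra algebra_simps)
  then show "abelian_group \<Omega>"
    by (simp add: ring_def)
  show "cring (ground :: 'k ring)"
    by (rule cring_from_type_algebra)
  show "module_axioms (ground :: 'k ring) \<Omega>"
    by unfold_locales (auto elim!: form_cases simp: form_algebra ring_of_type_algebra_def)
  show "assoc_algebra_axioms \<Omega>"
    by unfold_locales (auto elim!: form_cases simp: form_algebra mult.commute)
qed

sublocale \<Omega>: assoc_algebra \<Omega>
  by (rule assoc_algebra_\<Omega>)

lemma ring_\<Omega>: "ring \<Omega>"
  using assoc_algebra_\<Omega> by (simp add: assoc_algebra_def)

lemma \<Omega>_minus [simp]: "\<ominus>\<^bsub>\<Omega>\<^esub> form a b c d = form (- a) (- b) (- c) (- d)"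
  by (rule abelian_group.minus_equality[OF ring.is_abelian_group[OF ring_\<Omega>]]) simp_all

lemma \<Omega>_degree_simps [simp]:
  "\<Omega>_degree 0 = {form a 0 0 0 | a. True}"
  "\<Omega>_degree (Suc 0) = {form 0 b c 0 | b c. True}"
  "\<Omega>_degree 2 = {form 0 0 0 d | d. True}"
  by (auto simp: \<Omega>_degree_def)

lemma \<Omega>_degree_above: "k > 2 \<Longrightarrow> \<Omega>_degree k = {form 0 0 0 0}"
  by (simp add: \<Omega>_degree_def)

lemma degree_split:
  obtains "k = 0" | "k = Suc 0" | "k = 2" | "k > 2"
  by linarith

lemma submodule_degree: "submodule (\<Omega>_degree k) (ground :: 'k ring) \<Omega>"
  by (rule degree_split[of k]; rule \<Omega>.submoduleI) (auto simp: \<Omega>_degree_above)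

lemma finsum_degrees:
  assumes "u 0 \<in> carrier \<Omega>" "u (Suc 0) \<in> carrier \<Omega>" "u 2 \<in> carrier \<Omega>"
  shows "(\<Oplus>\<^bsub>\<Omega>\<^esub>k\<in>{..2::nat}. u k) = u 2 \<oplus>\<^bsub>\<Omega>\<^esub> (u (Suc 0) \<oplus>\<^bsub>\<Omega>\<^esub> u 0)"
proof -
  have "{..2::nat} = {2, Suc 0, 0}" by auto
  then show ?thesis
    using assms by (auto elim!: form_cases simp: Pi_def)
qed

lemma direct_sum_degrees:
  assumes "w \<in> carrier \<Omega>"
  shows "\<exists>!u. u \<in> (\<Pi>\<^sub>E k\<in>{..2}. \<Omega>_degree k) \<and> w = (\<Oplus>\<^bsub>\<Omega>\<^esub>k\<in>{..2}. u k)"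
proof -
  from assms obtain a b c d where w: "w = form a b c d" by (rule form_cases)
  have le2: "k \<le> 2 \<longleftrightarrow> k = 0 \<or> k = Suc 0 \<or> k = 2" for k :: nat
    by auto
  define u where "u = (\<lambda>k\<in>{..2::nat}. if k = 0 then form a 0 0 0
    else if k = 1 then form 0 b c 0 else form 0 0 0 d)"
  show ?thesis
  proof (rule ex1I)
    show "u \<in> (\<Pi>\<^sub>E k\<in>{..2}. \<Omega>_degree k) \<and> w = (\<Oplus>\<^bsub>\<Omega>\<^esub>k\<in>{..2}. u k)"
      by (subst finsum_degrees) (auto simp: u_def w le2 PiE_iff)
    fix v assume v: "v \<in> (\<Pi>\<^sub>E k\<in>{..2}. \<Omega>_degree k) \<and> w = (\<Oplus>\<^bsub>\<Omega>\<^esub>k\<in>{..2}. v k)"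
    then have "v 0 \<in> \<Omega>_degree 0" "v (Suc 0) \<in> \<Omega>_degree (Suc 0)" "v 2 \<in> \<Omega>_degree 2"
      by (auto simp: PiE_iff simp del: \<Omega>_degree_simps)
    then obtain a' b' c' d' where v': "v 0 = form a' 0 0 0" "v (Suc 0) = form 0 b' c' 0"
      "v 2 = form 0 0 0 d'"
      by auto
    have "w = v 2 \<oplus>\<^bsub>\<Omega>\<^esub> (v (Suc 0) \<oplus>\<^bsub>\<Omega>\<^esub> v 0)"
      using v by (simp add: finsum_degrees v')
    then have "a' = a" "b' = b" "c' = c" "d' = d"
      by (simp_all add: v' w)
    moreover have "v \<in> extensional {..2}" "u \<in> extensional {..2}"
      using v by (auto simp: PiE_iff u_def)
    ultimately show "v = u"
      by (rule_tac extensionalityI[where A = "{..2}"]) (auto simp: le2 v' u_def)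
  qed
qed

lemma wedge_degree:
  assumes "u \<in> \<Omega>_degree k" "v \<in> \<Omega>_degree m"
  shows "u \<otimes>\<^bsub>\<Omega>\<^esub> v \<in> \<Omega>_degree (k + m)"
  using assms
  by (rule_tac degree_split[of k]; rule_tac degree_split[of m])
    (auto simp: \<Omega>_degree_above numeral_2_eq_2[symmetric])

lemma differential_degree:
  assumes "u \<in> \<Omega>_degree k"
  shows "differential u \<in> \<Omega>_degree (Suc k)"
  using assms
  by (rule_tac degree_split[of k]) (auto simp: \<Omega>_degree_above numeral_2_eq_2[symmetric])

lemma differential_leibniz:
  assumes "u \<in> \<Omega>_degree k" "v \<in> carrier \<Omega>"
  shows "differential (u \<otimes>\<^bsub>\<Omega>\<^esub> v) =
    differential u \<otimes>\<^bsub>\<Omega>\<^esub> v \<oplus>\<^bsub>\<Omega>\<^esub> (- 1) ^ k \<odot>\<^bsub>\<Omega>\<^esub> (u \<otimes>\<^bsub>\<Omega>\<^esub> differential v)"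
  using assms
  by (rule_tac degree_split[of k]) (auto elim!: form_cases simp: \<Omega>_degree_above form_algebra)

lemma \<Omega>_generated: "alg_generate \<Omega> (\<Omega>_degree 0 \<union> differential ` \<Omega>_degree 0) = carrier \<Omega>"
proof -
  let ?G = "alg_generate \<Omega> (\<Omega>_degree 0 \<union> differential ` \<Omega>_degree 0)"
  have sub: "scalars \<Omega> \<union> (\<Omega>_degree 0 \<union> differential ` \<Omega>_degree 0) \<subseteq> carrier \<Omega>"
    by (auto simp: scalars_def)
  have G_mult: "u \<otimes>\<^bsub>\<Omega>\<^esub> v \<in> ?G" and G_add: "u \<oplus>\<^bsub>\<Omega>\<^esub> v \<in> ?G" if "u \<in> ?G" "v \<in> ?G" for u v
    using that by (auto simp: alg_generate_def intro: generate_ring.eng_mult generate_ring.eng_add)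
  have G_0: "form a 0 0 0 \<in> ?G" and G_d: "differential (form a 0 0 0) \<in> ?G" for a
    by (auto simp: alg_generate_def simp del: differential_form intro!: generate_ring.incl)
  \<comment> \<open>\<open>t dx = \<eta>\<close> and \<open>dy = \<zeta>\<close> for the coordinates \<open>x\<close> and \<open>y\<close>\<close>
  obtain t x where "t \<star> D\<^sub>1 x = \<e>" "D\<^sub>2 x = 0" using coordinate_D\<^sub>1 by blast
  then have \<eta>: "form 0 \<e> 0 0 \<in> ?G"
    using G_mult[OF G_0[of t] G_d[of x]] by simp
  obtain y where "D\<^sub>1 y = 0" "D\<^sub>2 y = \<e>" using coordinate_D\<^sub>2 by blast
  then have dy: "form 0 0 \<e> 0 \<in> ?G"
    using G_d[of y] by simp
  have vol: "volume \<in> ?G"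
    using G_mult[OF \<eta> dy] by (simp add: \<rho>_hom)
  have "form a b c d \<in> ?G" for a b c d
    using G_add[OF G_add[OF G_0[of a] G_mult[OF G_0[of b] \<eta>]]
        G_add[OF G_mult[OF G_0[of c] dy] G_mult[OF G_0[of d] vol]]]
    by simp
  then show ?thesis
    using ring.generate_ring_incl[OF ring_\<Omega> sub] by (auto simp: \<Omega>_carrier alg_generate_def)
qed

lemma differential_calculus_\<Omega>:
  "differential_calculus 2 alg \<Omega> \<Omega>_degree differential inclusion"
proof (intro differential_calculus.intro assoc_algebra_alg assoc_algebra_\<Omega>
    differential_calculus_axioms.intro submodule_degree direct_sum_degrees wedge_degree
    differential_degree differential_leibniz \<Omega>_generated)
  show "inclusion \<in> alg_hom alg \<Omega>"
    by (auto simp: alg_hom_def ring_hom_def)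
  show "bij_betw inclusion (carrier alg) (\<Omega>_degree 0)"
    by (auto simp: bij_betw_def inj_on_def)
  show "\<Omega>_degree 2 \<noteq> {\<zero>\<^bsub>\<Omega>\<^esub>}"
    using one_neq_zero by (auto dest!: equalityD1 simp: subset_iff)
  show "{a \<in> carrier alg. differential (form a 0 0 0) = \<zero>\<^bsub>\<Omega>\<^esub>} = scalars alg"
    using constants by (auto simp: scalars_def D\<^sub>1_linear D\<^sub>2_linear)
qed (auto elim!: form_cases simp: \<Omega>_degree_above form_algebra)

sublocale dc: differential_calculus 2 alg \<Omega> \<Omega>_degree differential inclusion
  by (rule differential_calculus_\<Omega>)

text \<open>The inverse of the automorphism \<open>\<nu>\<close> with \<open>a \<omega> = \<omega> \<nu>(a)\<close> for \<open>\<omega> = \<eta> \<and> \<zeta>\<close>.\<close>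

abbreviation "\<tau> \<equiv> (\<lambda>a. \<rho> (\<theta> a))"

lemma bij_\<tau>: "bij \<tau>"
  using bij_comp[OF bij_\<theta> bij_\<rho>] by (simp add: o_def)

lemma volume_mult: "volume \<otimes>\<^bsub>\<Omega>\<^esub> form a 0 0 0 = form 0 0 0 (\<tau> a)"
  by simp

lemma volume_form_volume: "dc.volume_form volume"
  unfolding dc.volume_form_def
proof (intro conjI bexI[of _ "inv_into UNIV \<tau>"] ballI)
  have \<tau>_inv: "\<tau> (inv_into UNIV \<tau> a) = a" for a
    by (rule surj_f_inv_f[OF bij_is_surj[OF bij_\<tau>], of a])
  have inv_\<tau>: "inv_into UNIV \<tau> b = a" if "\<tau> a = b" for a b
    using inv_f_f[OF bij_is_inj[OF bij_\<tau>], of a] that by simp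
  show "bij_betw (\<lambda>a. volume \<otimes>\<^bsub>\<Omega>\<^esub> form a 0 0 0) (carrier alg) (\<Omega>_degree 2)"
    unfolding volume_mult using surjD[OF bij_is_surj[OF bij_\<tau>]]
    by (intro bij_betwI') (auto simp: inj_eq[OF bij_is_inj[OF bij_\<tau>]])
  show "bij_betw (inv_into UNIV \<tau>) (carrier alg) (carrier alg)"
    using bij_imp_bij_inv[OF bij_\<tau>] by simp
  show "inv_into UNIV \<tau> \<in> alg_hom alg alg"
    by (auto simp: alg_hom_def ring_hom_def \<rho>_hom \<theta>_hom \<tau>_inv intro!: inv_\<tau>)
  show "form a 0 0 0 \<otimes>\<^bsub>\<Omega>\<^esub> volume = volume \<otimes>\<^bsub>\<Omega>\<^esub> form (inv_into UNIV \<tau> a) 0 0 0" for a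
    by (simp add: \<tau>_inv)
qed auto

lemma vol_iso_volume: "dc.vol_iso volume (form 0 0 0 (\<tau> a)) = a"
proof -
  have "inj_on (\<lambda>a. volume \<otimes>\<^bsub>\<Omega>\<^esub> form a 0 0 0) (carrier alg)"
    using volume_form_volume by (auto simp: dc.volume_form_def bij_betw_def)
  from the_inv_into_f_f[OF this, of a] show ?thesis
    by (simp add: dc.vol_iso_def)
qed

text \<open>A right-linear functional on the one-forms is determined by its values at \<open>\<eta>\<close> and \<open>\<zeta>\<close>. For the
  pairing with \<open>b \<eta> + c \<zeta>\<close> these values are \<open>- \<epsilon> \<tau>\<^sup>-\<^sup>1(c)\<close> and \<open>\<tau>\<^sup>-\<^sup>1(b)\<close>, so every pair of values occurs
  for exactly one one-form.\<close>

lemma integrating_form_volume: "dc.integrating_form volume"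
proof -
  let ?\<pi> = "dc.I_action 1 (dc.vol_iso volume)"
  have surj: "\<exists>b. a = \<tau> b" "\<exists>b. a = \<rho> b" "\<exists>b. a = \<theta> b" for a
    by (rule surjD[OF bij_is_surj], rule bij_\<tau> bij_\<rho> bij_\<theta>)+
  have \<pi>_add: "dc.vol_iso volume (form 0 0 0 (a + b)) =
      dc.vol_iso volume (form 0 0 0 a) + dc.vol_iso volume (form 0 0 0 b)"
    and \<pi>_mul: "dc.vol_iso volume (form 0 0 0 (a \<star> \<tau> b)) = dc.vol_iso volume (form 0 0 0 a) \<star> b"
    for a b
  proof -
    obtain a' where "a = \<tau> a'" using surj(1) by blast
    moreover obtain b' where "b = \<tau> b'" using surj(1) by blast
    ultimately show "dc.vol_iso volume (form 0 0 0 (a + b)) =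
        dc.vol_iso volume (form 0 0 0 a) + dc.vol_iso volume (form 0 0 0 b)"
      by (simp add: vol_iso_volume flip: \<rho>_hom(1) \<theta>_hom(1))
    show "dc.vol_iso volume (form 0 0 0 (a \<star> \<tau> b)) = dc.vol_iso volume (form 0 0 0 a) \<star> b"
      by (simp add: \<open>a = \<tau> a'\<close> vol_iso_volume flip: \<rho>_hom(3) \<theta>_hom(3))
  qed
  have \<pi>: "?\<pi> (form 0 b c 0) (form 0 b' c' 0) =
      dc.vol_iso volume (form 0 0 0 (b \<star> \<rho> c' - \<epsilon> \<bullet> (c \<star> \<theta> b')))" for b c b' c'
    by (simp add: dc.I_action_def)
  have at_basis: "?\<pi> (form 0 (\<tau> b) (\<tau> c) 0) (form 0 0 \<e> 0) = b"
    "?\<pi> (form 0 (\<tau> b) (\<tau> c) 0) (form 0 \<e> 0 0) = - (\<epsilon> \<bullet> c)" for b c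
  proof -
    have "\<tau> b \<star> \<rho> \<e> - \<epsilon> \<bullet> (\<tau> c \<star> \<theta> 0) = \<tau> b"
      "\<tau> b \<star> \<rho> 0 - \<epsilon> \<bullet> (\<tau> c \<star> \<theta> \<e>) = \<tau> (- (\<epsilon> \<bullet> c))"
      by (simp_all add: \<rho>_hom \<theta>_hom)
    then show "?\<pi> (form 0 (\<tau> b) (\<tau> c) 0) (form 0 0 \<e> 0) = b"
      "?\<pi> (form 0 (\<tau> b) (\<tau> c) 0) (form 0 \<e> 0 0) = - (\<epsilon> \<bullet> c)"
      by (simp_all only: \<pi> vol_iso_volume)
  qed
  have I_space: "f \<in> dc.I_space 1 \<longleftrightarrow> f \<in> extensional (\<Omega>_degree 1) \<and>
      (\<forall>b c b' c'. f (form 0 (b + b') (c + c') 0) = f (form 0 b c 0) + f (form 0 b' c' 0)) \<and>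
      (\<forall>b c a. f (form 0 (b \<star> \<rho> a) (c \<star> \<theta> a) 0) = f (form 0 b c 0) \<star> a)" for f
  proof -
    have "(\<forall>u\<in>\<Omega>_degree 1. P u) \<longleftrightarrow> (\<forall>b c. P (form 0 b c 0))" for P
      by auto
    then show ?thesis
      unfolding dc.I_space_def PiE_def by (simp add: Pi_def del: \<Omega>_degree_simps)
  qed
  have in_I: "?\<pi> (form 0 b c 0) \<in> dc.I_space 1" for b c
  proof -
    have "b \<star> \<rho> (c1 + c2) - \<epsilon> \<bullet> (c \<star> \<theta> (b1 + b2)) =
        (b \<star> \<rho> c1 - \<epsilon> \<bullet> (c \<star> \<theta> b1)) + (b \<star> \<rho> c2 - \<epsilon> \<bullet> (c \<star> \<theta> b2))" for b1 c1 b2 c2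
      by (simp add: form_algebra)
    moreover have "b \<star> \<rho> (c1 \<star> \<theta> a) - \<epsilon> \<bullet> (c \<star> \<theta> (b1 \<star> \<rho> a)) =
        (b \<star> \<rho> c1 - \<epsilon> \<bullet> (c \<star> \<theta> b1)) \<star> \<tau> a" for b1 c1 a
      by (simp add: form_algebra)
    moreover have "?\<pi> (form 0 b c 0) \<in> extensional (\<Omega>_degree 1)"
      unfolding dc.I_action_def by (rule restrict_extensional)
    ultimately show ?thesis
      by (simp only: I_space \<pi> \<pi>_add \<pi>_mul simp_thms)
  qed
  have "bij_betw ?\<pi> (\<Omega>_degree 1) (dc.I_space 1)"
    unfolding bij_betw_def
  proof
    show "inj_on ?\<pi> (\<Omega>_degree 1)"
    proof (rule inj_onI)
      fix u v assume uv: "u \<in> \<Omega>_degree 1" "v \<in> \<Omega>_degree 1" "?\<pi> u = ?\<pi> v"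
      obtain b c b' c' where u: "u = form 0 (\<tau> b) (\<tau> c) 0" and v: "v = form 0 (\<tau> b') (\<tau> c') 0"
      proof -
        obtain b\<^sub>0 c\<^sub>0 b\<^sub>1 c\<^sub>1 where u: "u = form 0 b\<^sub>0 c\<^sub>0 0" and v: "v = form 0 b\<^sub>1 c\<^sub>1 0"
          using uv(1,2) by auto
        obtain b c b' c' where "b\<^sub>0 = \<tau> b" "c\<^sub>0 = \<tau> c" "b\<^sub>1 = \<tau> b'" "c\<^sub>1 = \<tau> c'"
          using surj(1)[of b\<^sub>0] surj(1)[of c\<^sub>0] surj(1)[of b\<^sub>1] surj(1)[of c\<^sub>1] by blast
        with u v that show thesis by blast
      qed
      have "b = b'" "- (\<epsilon> \<bullet> c) = - (\<epsilon> \<bullet> c')"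
        using uv(3) at_basis unfolding u v by metis+
      then have "\<epsilon> \<bullet> \<epsilon> \<bullet> c = \<epsilon> \<bullet> \<epsilon> \<bullet> c'" by simp
      then have "c = c'" by (simp only: sign_cancel)
      then show "u = v" by (simp add: u v \<open>b = b'\<close>)
    qed
    show "?\<pi> ` \<Omega>_degree 1 = dc.I_space 1"
    proof
      show "?\<pi> ` \<Omega>_degree 1 \<subseteq> dc.I_space 1"
        using in_I by auto
      show "dc.I_space 1 \<subseteq> ?\<pi> ` \<Omega>_degree 1"
      proof
        fix \<phi> assume \<phi>: "\<phi> \<in> dc.I_space 1"
        \<comment> \<open>every one-form is \<open>\<eta> b + \<zeta> c\<close> for some \<open>b\<close> and \<open>c\<close>, because \<open>\<rho>\<close> and \<open>\<theta>\<close> are onto\<close>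
        have determined: "f = f'" if f: "f \<in> dc.I_space 1" "f' \<in> dc.I_space 1"
          and eq: "f (form 0 \<e> 0 0) = f' (form 0 \<e> 0 0)" "f (form 0 0 \<e> 0) = f' (form 0 0 \<e> 0)" for f f'
        proof (rule extensionalityI)
          show "f \<in> extensional (\<Omega>_degree 1)" "f' \<in> extensional (\<Omega>_degree 1)"
            using f by (auto simp: dc.I_space_def PiE_iff)
          fix u assume "u \<in> \<Omega>_degree 1"
          then obtain b\<^sub>0 c\<^sub>0 where u: "u = form 0 b\<^sub>0 c\<^sub>0 0" by auto
          obtain b where "b\<^sub>0 = \<rho> b" using surj(2) by blast
          moreover obtain c where "c\<^sub>0 = \<theta> c" using surj(3) by blast
          ultimately have "u = form 0 (\<rho> b) (\<theta> c) 0" by (simp add: u)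
          moreover have "f (form 0 (\<rho> b) (\<theta> c) 0) = f (form 0 \<e> 0 0) \<star> b + f (form 0 0 \<e> 0) \<star> c"
            if "f \<in> dc.I_space 1" for f
          proof -
            have "f (form 0 (\<e> \<star> \<rho> b + 0 \<star> \<rho> c) (0 \<star> \<theta> b + \<e> \<star> \<theta> c) 0) =
                f (form 0 \<e> 0 0) \<star> b + f (form 0 0 \<e> 0) \<star> c"
              using that unfolding I_space by presburger
            then show ?thesis by simp
          qed
          ultimately show "f u = f' u"
            using f eq by metis
        qed
        define b c where "b = \<phi> (form 0 0 \<e> 0)" and "c = - (\<epsilon> \<bullet> \<phi> (form 0 \<e> 0 0))"
        have "\<phi> = ?\<pi> (form 0 (\<tau> b) (\<tau> c) 0)"
          by (rule determined[OF \<phi> in_I]) (simp_all only: at_basis, simp_all add: b_def c_def sign)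
        then show "\<phi> \<in> ?\<pi> ` \<Omega>_degree 1"
          by auto
      qed
    qed
  qed
  moreover have "{1..<2} = {1::nat}"
    by auto
  ultimately show ?thesis
    by (simp add: dc.integrating_form_def volume_form_volume)
qed

end

section \<open>Homomorphisms and twisted derivations of Ore extensions\<close>

lemma additive_0:
  assumes "\<And>f g. h (f + g) = h f + (h g :: 'b::ab_group_add)"
  shows "h (0::'c::ab_group_add) = 0"
  using assms[of 0 0] by simp

text \<open>The value \<open>\<Sum> f\<^sub>i T\<^sup>i v\<close>, where the variable acts as the operator \<open>T\<close>. The product of an Ore extension
  is of this form, with \<open>T\<close> the left multiplication by \<open>y\<close>, and so is the substitution of \<open>Y\<close> for \<open>y\<close>, with
  \<open>T\<close> the right multiplication by \<open>Y\<close>.\<close>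

definition poly_action :: "('r poly \<Rightarrow> 'r poly) \<Rightarrow> 'r::comm_ring_1 poly \<Rightarrow> 'r poly \<Rightarrow> 'r poly"
  where "poly_action T f v =
    (\<Sum>i\<le>Polynomial.degree f. Polynomial.smult (Polynomial.coeff f i) ((T ^^ i) v))"

lemma poly_action_bound:
  assumes "Polynomial.degree f \<le> n"
  shows "poly_action T f v = (\<Sum>i\<le>n. Polynomial.smult (Polynomial.coeff f i) ((T ^^ i) v))"
  unfolding poly_action_def
  by (rule sum.mono_neutral_left) (use assms in \<open>auto simp: coeff_eq_0\<close>)

lemma poly_action_0 [simp]: "poly_action T 0 v = 0"
  by (simp add: poly_action_def)

lemma poly_action_pCons:
  "poly_action T (pCons b f) v = Polynomial.smult b v + poly_action T f (T v)"
proof -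
  have "poly_action T (pCons b f) v =
      (\<Sum>i\<le>Suc (Polynomial.degree f). Polynomial.smult (Polynomial.coeff (pCons b f) i) ((T ^^ i) v))"
    by (rule poly_action_bound) (simp add: degree_pCons_le)
  also have "\<dots> = Polynomial.smult b v + poly_action T f (T v)"
    by (simp add: sum.atMost_Suc_shift poly_action_def funpow_swap1 del: sum.atMost_Suc)
  finally show ?thesis .
qed

lemma poly_action_add: "poly_action T (f + g) v = poly_action T f v + poly_action T g v"
proof -
  let ?n = "max (Polynomial.degree f) (Polynomial.degree g)"
  have "Polynomial.degree (f + g) \<le> ?n"
    by (rule degree_add_le_max)
  then show ?thesis
    by (simp add: poly_action_bound[where n = ?n] smult_add_left sum.distrib)
qed

lemma poly_action_smult:
  "poly_action T (Polynomial.smult b f) v = Polynomial.smult b (poly_action T f v)"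
  by (induction f arbitrary: v) (simp_all add: poly_action_pCons smult_add_right)

locale ore_extension =
  fixes \<sigma> \<delta> :: "'r::comm_ring_1 \<Rightarrow> 'r"
  assumes \<sigma>_add: "\<sigma> (a + b) = \<sigma> a + \<sigma> b" and \<sigma>_mult: "\<sigma> (a * b) = \<sigma> a * \<sigma> b" and \<sigma>_one [simp]: "\<sigma> 1 = 1"
    and \<delta>_add: "\<delta> (a + b) = \<delta> a + \<delta> b" and \<delta>_mult: "\<delta> (a * b) = \<delta> a * b + \<sigma> a * \<delta> b"
begin

abbreviation mult (infixl \<open>\<star>\<close> 70)
  where "f \<star> g \<equiv> ore_mult \<sigma> \<delta> f g"

abbreviation y :: "'r poly" where "y \<equiv> [:0, 1:]"

lemma ore_mult_action: "f \<star> g = poly_action (ore_y_times \<sigma> \<delta>) f g"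
  by (simp add: ore_mult_def poly_action_def)

lemma \<sigma>_0 [simp]: "\<sigma> 0 = 0" and \<delta>_0 [simp]: "\<delta> 0 = 0" and \<delta>_1 [simp]: "\<delta> 1 = 0"
  using \<sigma>_add[of 0 0] \<delta>_add[of 0 0] \<delta>_mult[of 1 1] by simp_all

lemma y_times_pCons:
  "ore_y_times \<sigma> \<delta> (pCons b f) = pCons (\<delta> b) ([:\<sigma> b:] + ore_y_times \<sigma> \<delta> f)"
  by (simp add: ore_y_times_def map_poly_pCons)

lemma y_times_0 [simp]: "ore_y_times \<sigma> \<delta> 0 = 0"
  by (simp add: ore_y_times_def)

lemma y_times_add: "ore_y_times \<sigma> \<delta> (f + g) = ore_y_times \<sigma> \<delta> f + ore_y_times \<sigma> \<delta> g"
  by (induction f g rule: poly_induct2) (simp_all add: y_times_pCons \<sigma>_add \<delta>_add)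

lemma y_times_smult: "ore_y_times \<sigma> \<delta> (Polynomial.smult b g) =
    Polynomial.smult (\<sigma> b) (ore_y_times \<sigma> \<delta> g) + Polynomial.smult (\<delta> b) g"
  by (induction g) (simp_all add: y_times_pCons \<sigma>_mult \<delta>_mult smult_add_right)

lemma mult_pCons_left: "pCons b f \<star> g = Polynomial.smult b g + f \<star> ore_y_times \<sigma> \<delta> g"
  by (simp add: ore_mult_action poly_action_pCons)

lemma mult_add_left: "(f + g) \<star> h = f \<star> h + g \<star> h"
  by (simp add: ore_mult_action poly_action_add)

lemma mult_smult_left: "Polynomial.smult b f \<star> g = Polynomial.smult b (f \<star> g)"
  by (simp add: ore_mult_action poly_action_smult)

lemma mult_0_left [simp]: "0 \<star> g = 0"
  by (simp add: ore_mult_action)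

lemma mult_const_left [simp]: "[:b:] \<star> g = Polynomial.smult b g"
  by (simp add: mult_pCons_left)

lemma mult_one_left [simp]: "1 \<star> g = g"
  by (simp add: one_pCons)

lemma mult_y_left: "y \<star> g = ore_y_times \<sigma> \<delta> g"
  by (simp add: mult_pCons_left)

lemma mult_add_right: "f \<star> (g + h) = f \<star> g + f \<star> h"
  by (induction f arbitrary: g h) (simp_all add: mult_pCons_left y_times_add smult_add_right)

lemma mult_0_right [simp]: "f \<star> 0 = 0"
  by (induction f) (simp_all add: mult_pCons_left)

text \<open>The operators satisfy \<open>y \<circ> b = \<sigma>(b) y + \<delta>(b)\<close> (\<open>y_times_smult\<close>), so letting \<open>f\<close> act by
  left multiplication turns \<open>y \<star> f\<close> into a composition; associativity follows by induction on \<open>f\<close>.\<close>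

lemma mult_y_times_left: "ore_y_times \<sigma> \<delta> f \<star> g = ore_y_times \<sigma> \<delta> (f \<star> g)"
  by (induction f arbitrary: g)
    (simp_all add: y_times_pCons mult_pCons_left mult_add_left y_times_add y_times_smult)

lemma mult_assoc: "(f \<star> g) \<star> h = f \<star> (g \<star> h)"
  by (induction f arbitrary: g)
    (simp_all add: mult_pCons_left mult_add_left mult_smult_left mult_y_times_left)

lemma mult_shift_right: "f \<star> pCons 0 g = pCons 0 (f \<star> g)"
  by (induction f arbitrary: g) (simp_all add: mult_pCons_left y_times_pCons)

lemma mult_one_right [simp]: "f \<star> 1 = f"
proof (induction f)
  case (pCons b f)
  have "ore_y_times \<sigma> \<delta> 1 = pCons 0 1"
    by (simp add: one_pCons y_times_pCons)
  with pCons show ?case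
    by (simp add: mult_pCons_left mult_shift_right one_pCons[symmetric])
qed simp

lemma mult_pCons_right: "f \<star> pCons b g = f \<star> [:b:] + pCons 0 (f \<star> g)"
  using mult_add_right[of f "[:b:]" "pCons 0 g"] by (simp add: mult_shift_right)

lemma mult_y_right: "f \<star> y = pCons 0 f"
  using mult_shift_right[of f 1] by (simp add: one_pCons[symmetric])

lemma mult_pCons_const: "pCons c f \<star> [:b:] = [:c * b:] + f \<star> [:\<delta> b:] + pCons 0 (f \<star> [:\<sigma> b:])"
  by (simp add: mult_pCons_left y_times_pCons mult_pCons_right[of f "\<delta> b" "[:\<sigma> b:]"])

text \<open>Every element arises from coefficients by addition and right multiplication by \<open>y\<close>, which is the mere
  shift \<open>pCons 0\<close>. So an additive map that turns this shift into right multiplication by \<open>Y\<close> is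
  multiplicative once it is so on coefficients and respects the relation \<open>y b = \<sigma>(b) y + \<delta>(b)\<close>.\<close>

lemma multiplicative_extension:
  assumes add: "\<And>f g. h (f + g) = h f + h g"
    and shift: "\<And>f. h (pCons 0 f) = h f \<star> Y"
    and const: "\<And>a b. h [:a * b:] = h [:a:] \<star> h [:b:]"
    and rel: "\<And>b. Y \<star> h [:b:] = h [:\<sigma> b:] \<star> Y + h [:\<delta> b:]"
  shows "h (f \<star> g) = h f \<star> h g"
proof -
  note h_0 = additive_0[of h, OF add]
  have split: "h (pCons b f) = h [:b:] + h f \<star> Y" for b f
    using add[of "[:b:]" "pCons 0 f"] by (simp add: shift)
  have base: "h (f \<star> [:b:]) = h f \<star> h [:b:]" for f b
  proof (induction f arbitrary: b)
    case (pCons c f)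
    have "h (pCons c f \<star> [:b:]) = h [:c:] \<star> h [:b:] + h f \<star> (h [:\<delta> b:] + h [:\<sigma> b:] \<star> Y)"
      by (simp only: mult_pCons_const add shift const pCons mult_assoc mult_add_right add_ac)
    also have "\<dots> = h (pCons c f) \<star> h [:b:]"
      by (simp only: split[of c f] mult_add_left mult_assoc rel add.commute)
    finally show ?case .
  qed (simp add: h_0)
  show ?thesis
  proof (induction g)
    case (pCons b g)
    then show ?case
      by (simp only: mult_pCons_right[of f b g] add base shift split[of b g] mult_assoc mult_add_right)
  qed (simp add: h_0)
qed

text \<open>The analogue for twisted derivations: the relation \<open>rel\<close> is what \<open>y b = \<sigma>(b) y + \<delta>(b)\<close> becomes under
  \<open>\<Delta>\<close>, with \<open>Z\<close> in the role of \<open>\<Delta> y\<close>.\<close>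

lemma derivation_extension:
  assumes add: "\<And>f g. \<Delta> (f + g) = \<Delta> f + \<Delta> g"
    and shift: "\<And>f. \<Delta> (pCons 0 f) = \<Delta> f \<star> Y + f \<star> Z"
    and const: "\<And>a b. \<Delta> [:a * b:] = \<Delta> [:a:] \<star> h [:b:] + [:a:] \<star> \<Delta> [:b:]"
    and rel: "\<And>b. \<Delta> [:\<sigma> b:] \<star> Y + [:\<sigma> b:] \<star> Z + \<Delta> [:\<delta> b:] = Z \<star> h [:b:] + y \<star> \<Delta> [:b:]"
    and h_add: "\<And>f g. h (f + g) = h f + h g"
    and h_mult: "\<And>f g. h (f \<star> g) = h f \<star> h g"
    and h_y: "h y = Y"
  shows "\<Delta> (f \<star> g) = \<Delta> f \<star> h g + f \<star> \<Delta> g"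
proof -
  note zero = additive_0[of \<Delta>, OF add] additive_0[of h, OF h_add]
  \<comment> \<open>an opaque name keeps the rewrite rules for \<open>pCons\<close> from applying to \<open>y = [:0, 1:]\<close>\<close>
  define v where "v = y"
  have split: "\<Delta> (pCons b f) = \<Delta> [:b:] + (\<Delta> f \<star> Y + f \<star> Z)" for b f
    using add[of "[:b:]" "pCons 0 f"] by (simp add: shift)
  have split_id: "pCons b f = [:b:] + f \<star> v" for b f
    by (simp add: mult_y_right v_def)
  have h_v: "h v = Y"
    by (simp add: v_def h_y)
  have h_split: "h (pCons b f) = h [:b:] + h f \<star> Y" for b f
    by (simp only: split_id[of b f] h_add h_mult h_v)
  have h_rel: "Y \<star> h [:b:] = h [:\<sigma> b:] \<star> Y + h [:\<delta> b:]" for b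
  proof -
    have "h (v \<star> [:b:]) = h ([:\<sigma> b:] \<star> v + [:\<delta> b:])"
      by (simp add: mult_y_left y_times_pCons v_def)
    then show ?thesis
      by (simp only: h_v h_mult h_add)
  qed
  have base: "\<Delta> (f \<star> [:b:]) = \<Delta> f \<star> h [:b:] + f \<star> \<Delta> [:b:]" for f b
  proof (induction f arbitrary: b)
    case (pCons c f)
    have "\<Delta> (pCons c f \<star> [:b:]) =
        (\<Delta> [:c:] \<star> h [:b:] + [:c:] \<star> \<Delta> [:b:])
        + (\<Delta> f \<star> (h [:\<sigma> b:] \<star> Y + h [:\<delta> b:])
        + f \<star> (\<Delta> [:\<sigma> b:] \<star> Y + [:\<sigma> b:] \<star> Z + \<Delta> [:\<delta> b:]))"
      by (simp only: mult_pCons_const add shift const pCons mult_assoc mult_add_left mult_add_right add_ac)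
    also have "\<dots> = (\<Delta> [:c:] + (\<Delta> f \<star> Y + f \<star> Z)) \<star> h [:b:] + ([:c:] + f \<star> v) \<star> \<Delta> [:b:]"
      unfolding rel[folded v_def] h_rel[symmetric]
      by (simp only: mult_assoc mult_add_left mult_add_right add_ac)
    finally show ?case
      unfolding split[of c f, symmetric] split_id[of c f, symmetric] .
  qed (simp add: zero)
  show ?thesis
  proof (induction g)
    case (pCons b g)
    then show ?case
      by (simp only: mult_pCons_right[of f b g] add base shift split[of b g] h_split[of b g]
          mult_assoc mult_add_left mult_add_right add_ac)
  qed (simp add: zero)
qed

definition subst :: "'r poly \<Rightarrow> 'r poly \<Rightarrow> 'r poly"
  where "subst Y f = poly_action (\<lambda>r. r \<star> Y) f 1"

lemma subst_add: "subst Y (f + g) = subst Y f + subst Y g"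
  by (simp add: subst_def poly_action_add)

lemma subst_smult: "subst Y (Polynomial.smult b f) = Polynomial.smult b (subst Y f)"
  by (simp add: subst_def poly_action_smult)

lemma subst_pCons: "subst Y (pCons b f) = [:b:] + subst Y f \<star> Y"
proof -
  have "poly_action (\<lambda>r. r \<star> Y) f (r \<star> Y) = poly_action (\<lambda>r. r \<star> Y) f r \<star> Y" for r
    by (induction f arbitrary: r) (simp_all add: poly_action_pCons mult_add_left mult_smult_left)
  from this[of 1] show ?thesis
    by (simp add: subst_def poly_action_pCons one_pCons)
qed

lemma subst_0 [simp]: "subst Y 0 = 0"
  by (simp add: subst_def)

lemma subst_const [simp]: "subst Y [:b:] = [:b:]"
  by (simp add: subst_pCons)

lemma subst_mult:
  assumes "\<And>b. Y \<star> [:b:] = Polynomial.smult (\<sigma> b) Y + [:\<delta> b:]"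
  shows "subst Y (f \<star> g) = subst Y f \<star> subst Y g"
  by (rule multiplicative_extension[where Y = Y])
    (simp_all add: subst_add subst_pCons assms)

lemma subst_subst:
  assumes "\<And>b. Y \<star> [:b:] = Polynomial.smult (\<sigma> b) Y + [:\<delta> b:]" and "subst Y Z = y"
  shows "subst Y (subst Z f) = f"
  by (induction f) (simp_all add: subst_pCons subst_add subst_mult assms mult_y_right)

end

section \<open>The calculus of a Laurent Ore extension\<close>

lemma lconst_diff: "lconst (a - b) = lconst a - lconst b"
  using lconst_add[of "a - b" b] by simp

text \<open>The derivation \<open>x d/dx\<close>. Unlike \<open>d/dx\<close> it commutes up to a sign with every \<open>x \<mapsto> q x\<^sup>e\<close> with \<open>e = \<plusminus>1\<close>.\<close>

definition euler :: "'k::field laurent \<Rightarrow> 'k laurent"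
  where "euler = lin_ext (\<lambda>i. lconst (of_int i) * lX i)"

lemma euler_add: "euler (f + g) = euler f + euler g"
  by (simp add: euler_def lin_ext_add)

lemma euler_diff: "euler (f - g) = euler f - euler g"
  using euler_add[of "f - g" g] by simp

lemma euler_single: "euler (Poly_Mapping.single i c) = Poly_Mapping.single i (of_int i * c)"
  by (simp only: euler_def lin_ext_single lconst_lX) (simp only: lconst_def mult_single add_0 mult.commute)

lemma euler_lconst [simp]: "euler (lconst c) = 0"
  by (simp add: lconst_def euler_single)

lemma euler_0 [simp]: "euler 0 = 0"
  using euler_lconst[of 0] by simp

lemma euler_lX: "euler (lX 1) = lX 1"
  by (simp add: lX_def euler_single)

lemma euler_mult: "euler (f * g) = euler f * g + f * euler g"
proof (induction f rule: laurent_induct)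
  case (1 i c)
  show ?case
    by (induction g rule: laurent_induct)
      (simp_all add: euler_add euler_single mult_single single_add[symmetric] algebra_simps)
qed (simp add: euler_add algebra_simps)

lemma lookup_euler: "Poly_Mapping.lookup (euler f) i = of_int i * Poly_Mapping.lookup f i"
  by (induction f rule: laurent_induct)
    (simp_all add: euler_add euler_single lookup_add lookup_single when_def algebra_simps)

lemma euler_eq_0:
  assumes "euler (f :: 'k::field_char_0 laurent) = 0"
  shows "f = lconst (Poly_Mapping.lookup f 0)"
proof (rule poly_mapping_eqI)
  fix i
  have "of_int i * Poly_Mapping.lookup f i = 0"
    using lookup_euler[of f i] assms by simp
  then show "Poly_Mapping.lookup f i = Poly_Mapping.lookup (lconst (Poly_Mapping.lookup f 0)) i"
    by (auto simp: lconst_def lookup_single when_def)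
qed

locale laurent_ore = ore_extension \<sigma> \<delta>
  for \<sigma> \<delta> :: "'k::field_char_0 laurent \<Rightarrow> 'k laurent" +
  assumes \<sigma>_lconst: "\<sigma> (lconst c) = lconst c" and \<delta>_lconst: "\<delta> (lconst c) = 0"
begin

lemma y_times_lconst:
  "ore_y_times \<sigma> \<delta> (Polynomial.smult (lconst c) f) = Polynomial.smult (lconst c) (ore_y_times \<sigma> \<delta> f)"
  by (simp add: y_times_smult \<sigma>_lconst \<delta>_lconst)

sublocale typed_algebra "\<lambda>c. Polynomial.smult (lconst c)" "ore_mult \<sigma> \<delta>" 1
proof
  show "f \<star> Polynomial.smult (lconst c) g = Polynomial.smult (lconst c) (f \<star> g)" for f g c
    by (induction f arbitrary: g)
      (simp_all add: mult_pCons_left y_times_lconst smult_add_right mult.commute)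
qed (simp_all add: smult_add_right smult_add_left lconst_add lconst_mult mult_assoc mult_add_left
    mult_add_right mult_smult_left)

lemma alg_eq: "alg = ore_algebra \<sigma> \<delta>"
  by (simp add: alg_def ore_algebra_def)

end

text \<open>The data \<open>\<epsilon>\<close> and \<open>g\<close> prescribe the automorphism \<open>\<rho>\<close> that is the identity on Laurent polynomials and
  sends \<open>y\<close> to \<open>\<epsilon> y + g\<close>. That \<open>\<rho>\<close> respects \<open>y b = \<sigma>(b) y + \<delta>(b)\<close> is \<open>\<delta>_sign\<close>, and that the
  \<open>\<rho>\<close>-derivation with \<open>x \<mapsto> x\<close> and \<open>y \<mapsto> 0\<close> respects it is \<open>\<delta>_euler\<close>. By \<open>\<sigma>_\<delta>\<close> the map \<open>\<sigma>\<close> extends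
  to an automorphism that fixes \<open>y\<close>, and by \<open>\<sigma>_g\<close> this one commutes with \<open>\<rho>\<close>.\<close>

locale twisted_ore = laurent_ore \<sigma> \<delta>
  for \<sigma> \<delta> :: "'k::field_char_0 laurent \<Rightarrow> 'k laurent" +
  fixes \<epsilon> :: 'k and g :: "'k laurent"
  assumes sign: "\<epsilon> * \<epsilon> = 1" and bij_\<sigma>: "bij \<sigma>"
    and euler_\<sigma>: "euler (\<sigma> b) = lconst \<epsilon> * \<sigma> (euler b)"
    and \<sigma>_\<delta>: "\<sigma> (\<delta> b) = \<delta> (\<sigma> b)"
    and \<sigma>_g: "\<sigma> g = g"
    and \<delta>_sign: "(1 - lconst \<epsilon>) * \<delta> b = g * (b - \<sigma> b)"
    and \<delta>_euler: "\<delta> (euler b) = g * euler (\<sigma> b) + euler (\<delta> b)"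
begin

lemma lconst_sign: "lconst \<epsilon> * lconst \<epsilon> = 1"
  by (simp add: lconst_mult[symmetric] sign)

abbreviation "\<rho> \<equiv> subst [:g, lconst \<epsilon>:]"

abbreviation "\<theta> \<equiv> map_poly \<sigma>"

text \<open>On coefficients this is \<open>euler\<close>; the outer \<open>\<rho>\<close> appears because \<open>D\<^sub>\<eta>(b y\<^sup>j) = D\<^sub>\<eta>(b) \<rho>(y)\<^sup>j\<close> for a
  \<open>\<rho>\<close>-derivation that kills \<open>y\<close>.\<close>

abbreviation "D\<^sub>\<eta> f \<equiv> \<rho> (map_poly euler f)"

lemma rho_relation: "[:g, lconst \<epsilon>:] \<star> [:b:] = Polynomial.smult (\<sigma> b) [:g, lconst \<epsilon>:] + [:\<delta> b:]"
proof -
  have "g * b + lconst \<epsilon> * \<delta> b = \<sigma> b * g + \<delta> b"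
    using \<delta>_sign[of b] by (simp add: algebra_simps)
  then show ?thesis
    by (simp add: mult_pCons_left y_times_pCons mult.commute)
qed

text \<open>The substitution \<open>y \<mapsto> \<epsilon> y - \<epsilon> g\<close> is inverse to \<open>\<rho>\<close> since \<open>\<epsilon>\<^sup>2 = 1\<close>; it is a homomorphism as well.\<close>

lemma rho_inverse_relation: "[:- lconst \<epsilon> * g, lconst \<epsilon>:] \<star> [:b:] =
    Polynomial.smult (\<sigma> b) [:- lconst \<epsilon> * g, lconst \<epsilon>:] + [:\<delta> b:]"
proof -
  have "lconst \<epsilon> * ((1 - lconst \<epsilon>) * \<delta> b) = lconst \<epsilon> * (g * (b - \<sigma> b))"
    by (simp only: \<delta>_sign)
  then have "lconst \<epsilon> * \<delta> b - \<delta> b = lconst \<epsilon> * g * b - lconst \<epsilon> * g * \<sigma> b"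
    by (simp add: algebra_simps) (simp add: mult.assoc[symmetric] lconst_sign)
  then have "- lconst \<epsilon> * g * b + lconst \<epsilon> * \<delta> b = \<sigma> b * (- lconst \<epsilon> * g) + \<delta> b"
    by (simp add: algebra_simps)
  then show ?thesis
    by (simp add: mult_pCons_left y_times_pCons mult.commute)
qed

lemma bij_rho: "bij \<rho>"
proof (rule bij_betw_byWitness[where f' = "subst [:- lconst \<epsilon> * g, lconst \<epsilon>:]"])
  show "\<forall>f\<in>UNIV. subst [:- lconst \<epsilon> * g, lconst \<epsilon>:] (\<rho> f) = f"
    by (intro ballI subst_subst rho_inverse_relation)
      (simp add: subst_pCons mult.assoc[symmetric] lconst_sign)
  show "\<forall>f\<in>UNIV. \<rho> (subst [:- lconst \<epsilon> * g, lconst \<epsilon>:] f) = f"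
    by (intro ballI subst_subst rho_relation)
      (simp add: subst_pCons mult.assoc[symmetric] lconst_sign)
qed simp_all

lemma rho_y: "\<rho> y = [:g, lconst \<epsilon>:]"
  by (simp add: subst_pCons mult_add_left)

lemma theta_add: "\<theta> (f + h) = \<theta> f + \<theta> h"
  by (rule poly_eqI) (simp add: coeff_map_poly \<sigma>_add)

lemma theta_smult: "\<theta> (Polynomial.smult b f) = Polynomial.smult (\<sigma> b) (\<theta> f)"
  by (rule poly_eqI) (simp add: coeff_map_poly \<sigma>_mult)

lemma theta_pCons [simp]: "\<theta> (pCons b f) = pCons (\<sigma> b) (\<theta> f)"
  by (simp add: map_poly_pCons)

lemma theta_mult: "\<theta> (f \<star> h) = \<theta> f \<star> \<theta> h"
  by (rule multiplicative_extension[where Y = y])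
    (simp_all add: theta_add mult_y_right \<sigma>_mult mult_y_left y_times_pCons \<sigma>_\<delta>)

lemma bij_theta: "bij \<theta>"
proof (rule bij_betw_byWitness[where f' = "map_poly (inv_into UNIV \<sigma>)"])
  have inv: "inv_into UNIV \<sigma> (\<sigma> b) = b" "\<sigma> (inv_into UNIV \<sigma> b) = b" for b
    using bij_\<sigma> by (simp_all add: bij_is_inj bij_is_surj surj_f_inv_f)
  have inv_0: "inv_into UNIV \<sigma> 0 = 0"
    using inv(1)[of 0] by simp
  show "\<forall>f\<in>UNIV. map_poly (inv_into UNIV \<sigma>) (\<theta> f) = f" "\<forall>f\<in>UNIV. \<theta> (map_poly (inv_into UNIV \<sigma>) f) = f"
    by (auto intro!: poly_eqI simp: coeff_map_poly inv_0 inv)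
qed simp_all

lemma map_euler_add: "map_poly euler (f + h) = map_poly euler f + map_poly euler h"
  by (rule poly_eqI) (simp add: coeff_map_poly euler_add)

lemma map_euler_pCons [simp]: "map_poly euler (pCons b f) = pCons (euler b) (map_poly euler f)"
  by (simp add: map_poly_pCons)

lemma map_euler_lconst:
  "map_poly euler (Polynomial.smult (lconst c) f) = Polynomial.smult (lconst c) (map_poly euler f)"
  by (rule poly_eqI) (simp add: coeff_map_poly euler_mult)

lemma rho_mult: "\<rho> (f \<star> h) = \<rho> f \<star> \<rho> h"
  by (rule subst_mult) (rule rho_relation)

lemma eta_derivation: "D\<^sub>\<eta> (f \<star> h) = D\<^sub>\<eta> f \<star> \<rho> h + f \<star> D\<^sub>\<eta> h"
proof (rule derivation_extension[where Y = "[:g, lconst \<epsilon>:]" and Z = 0])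
  fix b
  have "euler (\<sigma> b) * g + euler (\<delta> b) = \<delta> (euler b)" "euler (\<sigma> b) * lconst \<epsilon> = \<sigma> (euler b)"
    using \<delta>_euler[of b] euler_\<sigma>[of b]
    by (simp_all add: mult.commute) (simp add: mult.assoc[symmetric] lconst_sign)
  then show "D\<^sub>\<eta> [:\<sigma> b:] \<star> [:g, lconst \<epsilon>:] + [:\<sigma> b:] \<star> 0 + D\<^sub>\<eta> [:\<delta> b:] =
      0 \<star> \<rho> [:b:] + y \<star> D\<^sub>\<eta> [:b:]"
    by (simp add: mult_y_left y_times_pCons)
qed (simp_all add: map_euler_add subst_add rho_mult rho_y subst_pCons euler_mult)

text \<open>The formal derivative kills the coefficients and maps \<open>y\<close> to \<open>1\<close>; applied to
  \<open>y b = \<sigma>(b) y + \<delta>(b)\<close> it gives \<open>\<theta>(b) = \<sigma>(b)\<close>.\<close>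

lemma y_derivation: "pderiv (f \<star> h) = pderiv f \<star> \<theta> h + f \<star> pderiv h"
  by (rule derivation_extension[where Y = y and Z = 1])
    (simp_all add: pderiv_add pderiv_pCons theta_add theta_mult mult_y_right)

lemma rho_theta: "\<rho> (\<theta> f) = \<theta> (\<rho> f)"
  by (induction f) (simp_all add: subst_pCons theta_add theta_mult \<sigma>_g \<sigma>_lconst)

lemma eta_theta: "D\<^sub>\<eta> (\<theta> f) = Polynomial.smult (lconst \<epsilon>) (\<theta> (D\<^sub>\<eta> f))"
proof -
  have "map_poly euler (\<theta> f) = Polynomial.smult (lconst \<epsilon>) (\<theta> (map_poly euler f))"
    by (rule poly_eqI) (simp add: coeff_map_poly euler_\<sigma>)
  then show ?thesis
    by (simp add: subst_smult rho_theta)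
qed

lemma pderiv_rho: "pderiv (\<rho> f) = Polynomial.smult (lconst \<epsilon>) (\<rho> (pderiv f))"
proof (induction f)
  case (pCons b f)
  have "\<rho> f \<star> [:lconst \<epsilon>:] = Polynomial.smult (lconst \<epsilon>) (\<rho> f)"
    using mul_scl_right[of "\<rho> f" \<epsilon> 1] by simp
  then show ?case
    using pCons
    by (simp add: subst_pCons pderiv_add y_derivation pderiv_pCons subst_add smult_add_right
        mult_smult_left \<sigma>_g \<sigma>_lconst add.commute)
qed simp

lemma map_euler_pderiv: "map_poly euler (pderiv f) = pderiv (map_poly euler (f :: 'k laurent poly))"
proof (rule poly_eqI)
  fix n
  have "euler (of_nat m * b) = of_nat m * euler b" for m and b :: "'k laurent"
    by (induction m) (simp_all add: euler_add algebra_simps)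
  then show "Polynomial.coeff (map_poly euler (pderiv f)) n = Polynomial.coeff (pderiv (map_poly euler f)) n"
    by (simp only: coeff_map_poly[where f = euler, OF euler_0] coeff_pderiv)
qed

text \<open>As \<open>\<rho>\<close> is injective, \<open>D\<^sub>\<eta> f = 0\<close> makes every coefficient of \<open>f\<close> a scalar; the vanishing of the formal
  derivative then removes those of positive degree. Both steps need characteristic zero.\<close>

lemma twisted_constants:
  assumes "D\<^sub>\<eta> f = 0" and "pderiv f = 0"
  shows "\<exists>c. f = Polynomial.smult (lconst c) 1"
proof -
  have "map_poly euler f = 0"
    using assms(1) bij_is_inj[OF bij_rho] injD[of \<rho> "map_poly euler f" 0] by simp
  then have coeff: "euler (Polynomial.coeff f n) = 0" for n
    using coeff_map_poly[of euler f n] by simp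
  have "Polynomial.coeff f (Suc n) = 0" for n
  proof (rule poly_mapping_eqI)
    fix i
    have nat: "Poly_Mapping.lookup (of_nat m * b) i = of_nat m * Poly_Mapping.lookup b i" for m and b :: "'k laurent"
      by (induction m) (simp_all add: lookup_add algebra_simps)
    have "of_nat (Suc n) * Poly_Mapping.lookup (Polynomial.coeff f (Suc n)) i = 0"
      using assms(2) nat[of "Suc n"] coeff_pderiv[of f n] by (simp del: of_nat_Suc)
    then show "Poly_Mapping.lookup (Polynomial.coeff f (Suc n)) i = Poly_Mapping.lookup 0 i"
      by (simp del: of_nat_Suc)
  qed
  then have "f = [:Polynomial.coeff f 0:]"
    by (intro poly_eqI) (simp add: coeff_pCons split: nat.split)
  also have "Polynomial.coeff f 0 = lconst (Poly_Mapping.lookup (Polynomial.coeff f 0) 0)"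
    by (rule euler_eq_0[OF coeff])
  finally have "f = Polynomial.smult (lconst (Poly_Mapping.lookup (Polynomial.coeff f 0) 0)) 1"
    by simp
  then show ?thesis ..
qed

sublocale calculus: twisted_calculus "\<lambda>c. Polynomial.smult (lconst c)" "ore_mult \<sigma> \<delta>" 1 \<rho> \<theta> "\<lambda>f. D\<^sub>\<eta> f" pderiv \<epsilon>
proof
  \<comment> \<open>the form \<open>\<eta>\<close> is \<open>x\<^sup>-\<^sup>1 dx\<close>\<close>
  show "\<exists>u f. u \<star> D\<^sub>\<eta> f = 1 \<and> pderiv f = 0"
    by (intro exI[of _ "[:lX (- 1):]"] exI[of _ "[:lX 1:]"])
      (simp add: euler_lX lX_mult lX_0 pderiv_pCons one_pCons)
  show "\<exists>f. D\<^sub>\<eta> f = 0 \<and> pderiv f = 1"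
  proof (intro exI conjI)
    have "euler (1 :: 'k laurent) = 0"
      using euler_lconst[of 1] by simp
    then show "D\<^sub>\<eta> y = 0" by simp
  qed (simp add: pderiv_pCons)
  show "\<exists>c. f = Polynomial.smult (lconst c) 1" if "D\<^sub>\<eta> f = 0" "pderiv f = 0" for f
    using that by (rule twisted_constants)
  show "D\<^sub>\<eta> (pderiv f) = Polynomial.smult (lconst \<epsilon>) (pderiv (D\<^sub>\<eta> f))" for f
    by (simp add: pderiv_rho map_euler_pderiv mult.assoc[symmetric] lconst_sign)
qed (simp_all add: sign bij_rho bij_theta subst_add subst_smult theta_add theta_smult \<sigma>_lconst
    rho_mult theta_mult map_euler_add map_euler_lconst pderiv_add pderiv_smult eta_derivation
    y_derivation rho_theta eta_theta pderiv_rho one_pCons)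

lemma integrable_calculus:
  "\<exists>(W :: ('k, nat \<Rightarrow> 'k laurent poly) module) gr d \<iota>.
    differential_calculus 2 (ore_algebra \<sigma> \<delta>) W gr d \<iota> \<and>
    differential_calculus.integrable 2 (ore_algebra \<sigma> \<delta>) W gr \<iota>"
  unfolding alg_eq[symmetric]
  using calculus.differential_calculus_\<Omega> calculus.integrating_form_volume
  unfolding calculus.dc.integrable_def[symmetric] by (metis calculus.dc.integrable_def)

end

section \<open>Gelfand-Kirillov dimension from a filtration\<close>

lemma log_monomial_tendsto:
  assumes "K > 0"
  shows "(\<lambda>n. ereal (log (real n) (K * real n ^ d))) \<longlonglongrightarrow> ereal (real d)"
proof -
  have "(\<lambda>n. ln K / ln (real n) + real d) \<longlonglongrightarrow> 0 + real d"
    by (intro tendsto_add tendsto_const tendsto_divide_0[OF tendsto_const]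
        filterlim_at_top_imp_at_infinity filterlim_compose[OF ln_at_top filterlim_real_sequentially])
  moreover have "\<forall>\<^sub>F n in sequentially. ln K / ln (real n) + real d = log (real n) (K * real n ^ d)"
    using eventually_gt_at_top[of 1]
  proof eventually_elim
    case (elim n)
    then show ?case
      using assms by (simp add: log_def ln_mult ln_realpow add_divide_distrib)
  qed
  ultimately show ?thesis
    by (auto intro: Lim_transform_eventually)
qed

context typed_algebra
begin

lemma ring_alg: "ring alg"
  using assoc_algebra_alg by (simp add: assoc_algebra_def)

lemma submodule_iff_subspace: "submodule U (ground :: 'k ring) alg \<longleftrightarrow> subspace U"
proof
  assume "submodule U (ground :: 'k ring) alg"
  then interpret submodule U "ground :: 'k ring" alg .
  show "subspace U"
    using one_closed m_closed smult_closed
    by (intro subspaceI) (auto simp: ring_of_type_algebra_def)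
next
  assume "subspace U"
  moreover have "\<ominus>\<^bsub>alg\<^esub> a = - a" for a
    by (rule abelian_group.minus_equality[OF ring.is_abelian_group[OF ring_alg]]) simp_all
  ultimately show "submodule U (ground :: 'k ring) alg"
    by (intro module.submoduleI[OF assoc_algebra.axioms(2)[OF assoc_algebra_alg]])
      (auto simp: subspace_0 subspace_neg subspace_add subspace_scale)
qed

lemma lin_span_alg: "lin_span alg S = span S"
  by (simp add: lin_span_def submodule_iff_subspace span_def hull_def)

lemma scalars_alg: "scalars alg = range (\<lambda>c. c \<bullet> \<e>)"
  by (simp add: scalars_def)

lemma subfield_scalars: "subfield (scalars alg) alg"
proof -
  have "field (ground :: 'k ring)"
    by (rule field_from_type_algebra)
  moreover have "ring_hom_ring (ground :: 'k ring) alg (\<lambda>c. c \<bullet> \<e>)"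
    by (intro ring_hom_ringI2 ring_alg ring_from_type_algebra ring_hom_memI)
      (auto simp: ring_of_type_algebra_def mul_linear scl_linear)
  ultimately have "subfield ((\<lambda>c. c \<bullet> \<e>) ` carrier (ground :: 'k ring)) alg"
    by (intro ring_hom_ring.img_is_subfield(2)[OF _ field.carrier_is_subfield]) (auto simp: one_neq_zero)
  then show ?thesis
    by (simp add: scalars_alg ring_of_type_algebra_def)
qed

lemma line_extension_alg: "ring.line_extension alg (scalars alg) a E = {c \<bullet> a + u | c u. u \<in> E}"
  by (auto simp: ring.line_extension_def[OF ring_alg] set_add_def set_mult_def r_coset_def
      scalars_alg mul_linear)

lemma span_insert_line: "span (insert a B) = {c \<bullet> a + u | c u. u \<in> span B}"
proof (intro Set.set_eqI iffI)
  fix x assume "x \<in> span (insert a B)"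
  then obtain k where "x - k \<bullet> a \<in> span B"
    by (auto simp: span_insert)
  moreover have "x = k \<bullet> a + (x - k \<bullet> a)" by simp
  ultimately show "x \<in> {c \<bullet> a + u | c u. u \<in> span B}" by blast
next
  fix x assume "x \<in> {c \<bullet> a + u | c u. u \<in> span B}"
  then obtain c u where "x = c \<bullet> a + u" "u \<in> span B" by blast
  then have "x - c \<bullet> a \<in> span B" by simp
  then show "x \<in> span (insert a B)"
    by (auto simp: span_insert)
qed

text \<open>A line extension adjoins one basis vector.\<close>

lemma dimension_span:
  assumes "finite B" "independent B"
  shows "ring.dimension alg (card B) (scalars alg) (span B)"
  using assms
proof (induction B rule: finite_induct)
  case empty
  then show ?case
    using ring.zero_dim[OF ring_alg, of "scalars alg"] by simp
next
  case (insert a B)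
  have "span (insert a B) = ring.line_extension alg (scalars alg) a (span B)"
    by (simp add: line_extension_alg span_insert_line)
  moreover have "a \<notin> span B" "independent B"
    using insert by (auto simp: independent_insert)
  ultimately show ?case
    using insert ring.Suc_dim[OF ring_alg, of a "span B" "card B" "scalars alg"] by simp
qed

lemma finite_dimension_span:
  assumes "ring.finite_dimension alg (scalars alg) V"
  obtains B where "finite B" "V = span B"
proof -
  have "\<exists>B. finite B \<and> E = span B" if "ring.dimension alg n (scalars alg) E" for n E
    using that
  proof (induction n K\<equiv>"scalars alg" E rule: ring.dimension.induct[OF ring_alg, consumes 1, case_names 1 2])
    case 1
    show ?case by (intro exI[of _ "{}"]) simp
  next
    case (2 a E n)
    then obtain B where "finite B" "E = span B" by blast
    then show ?case
      using 2 by (intro exI[of _ "insert a B"]) (simp add: line_extension_alg span_insert_line)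
  qed
  with assms that show ?thesis
    unfolding ring.finite_dimension_def[OF ring_alg] by blast
qed

lemma finite_dimension_spanI:
  assumes "finite B"
  shows "ring.finite_dimension alg (scalars alg) (span B)"
proof -
  obtain B' where B': "B' \<subseteq> B" "independent B'" "B \<subseteq> span B'"
    by (rule maximal_independent_subset)
  then have "span B' = span B"
    by (meson span_mono span_minimal subspace_span subset_antisym)
  then show ?thesis
    using dimension_span[of B'] B' assms finite_subset
    unfolding ring.finite_dimension_def[OF ring_alg] by metis
qed

text \<open>This moves dimension counts over the copy of the ground field inside the algebra to the ground field
  itself, where subspaces, spans and bases are available.\<close>

lemma ring_dim_eq_dim:
  assumes "subspace E" "E \<subseteq> span S" "finite S"
  shows "ring.dim alg (scalars alg) E = dim E"
proof -
  obtain B where B: "B \<subseteq> E" "independent B" "E \<subseteq> span B" "card B = dim E"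
    by (rule basis_exists)
  then have "finite B"
    using independent_span_bound[of S B] assms by blast
  moreover have "span B = E"
    using B assms(1) by (simp add: span_minimal subset_antisym)
  ultimately show ?thesis
    using ring.dimI[OF ring_alg subfield_scalars, of "dim E" E] dimension_span[of B] B
    by (simp add: over_def)
qed

lemma card_le_dim:
  assumes "independent B" "B \<subseteq> E" "E \<subseteq> span S" "finite S"
  shows "card B \<le> dim E"
proof -
  obtain B' where B': "B' \<subseteq> E" "independent B'" "E \<subseteq> span B'" "card B' = dim E"
    by (rule basis_exists)
  then have "finite B'"
    using independent_span_bound[of S B'] assms by blast
  then show ?thesis
    using independent_span_bound[of B' B] assms B' by auto
qed

lemma growth_space_alg:
  "growth_space alg V n = span {foldr (\<star>) vs \<e> | vs. set vs \<subseteq> V \<and> length vs \<le> n}"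
proof -
  have "monoid.mult alg = (\<star>)" by (simp add: alg_def)
  then show ?thesis
    by (simp add: growth_space_def lin_span_alg)
qed


text \<open>A finite-dimensional \<open>V\<close> lies in some \<open>F m\<close>, so that products of at most \<open>n\<close> of its elements lie in
  \<open>F (m * n)\<close>, and the growth of \<open>V\<close> is at most of order \<open>n\<^sup>d\<close>. Conversely one \<open>V\<close> with that many independent
  words attains this order.\<close>

lemma GKdim_eqI:
  fixes F :: "nat \<Rightarrow> 'a set"
  assumes F_subspace: "\<And>N. subspace (F N)" and F_one: "\<e> \<in> F 0"
    and F_mul: "\<And>N M a b. a \<in> F N \<Longrightarrow> b \<in> F M \<Longrightarrow> a \<star> b \<in> F (N + M)"
    and F_mono: "\<And>N M. N \<le> M \<Longrightarrow> F N \<subseteq> F M" and F_exhaust: "\<And>a. \<exists>N. a \<in> F N"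
    and F_dim: "\<And>N. \<exists>S. finite S \<and> F N \<subseteq> span S \<and> card S \<le> C * (N + 1) ^ d"
    and V: "finite V" and k: "k > 0"
    and lower: "\<And>n. \<exists>B. independent B \<and> B \<subseteq> {foldr (\<star>) vs \<e> | vs. set vs \<subseteq> V \<and> length vs \<le> n} \<and>
      k * real n ^ d \<le> real (card B)"
  shows "GKdim alg = ereal (real d)"
proof -
  define g where "g U n = log (real n) (real (ring.dim alg (scalars alg) (growth_space alg U n)))" for U n
  have growth_bound: "\<exists>m>0. \<forall>n. growth_space alg (span B) n \<subseteq> F (m * n)" if B: "finite B" for B
  proof -
    obtain N where N: "b \<in> F (N b)" for b using F_exhaust by metis
    define m where "m = Suc (\<Sum>b\<in>B. N b)"
    have "N b \<le> m" if "b \<in> B" for b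
      using member_le_sum[of b B N] that B by (simp add: m_def)
    then have "B \<subseteq> F m"
      using N F_mono by blast
    then have span: "span B \<subseteq> F m"
      by (rule span_minimal[OF _ F_subspace])
    have prod: "foldr (\<star>) vs \<e> \<in> F (m * length vs)" if "set vs \<subseteq> span B" for vs
      using that
    proof (induction vs)
      case (Cons v vs)
      then have "v \<star> foldr (\<star>) vs \<e> \<in> F (m + m * length vs)"
        using span by (intro F_mul) auto
      then show ?case by simp
    qed (simp add: F_one)
    have "growth_space alg (span B) n \<subseteq> F (m * n)" for n
    proof -
      have "foldr (\<star>) vs \<e> \<in> F (m * n)" if "set vs \<subseteq> span B" "length vs \<le> n" for vs
        using prod[OF that(1)] F_mono[of "m * length vs" "m * n"] that(2) by auto
      then show ?thesis
        unfolding growth_space_alg by (intro span_minimal F_subspace) auto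
    qed
    then show ?thesis
      by (intro exI[of _ m]) (simp add: m_def)
  qed
  have dim_growth: "ring.dim alg (scalars alg) (growth_space alg (span B) n) = dim (growth_space alg (span B) n)"
    if B: "finite B" for B n
  proof -
    obtain m where "growth_space alg (span B) n \<subseteq> F (m * n)" using growth_bound[OF B] by blast
    moreover obtain S where "finite S" "F (m * n) \<subseteq> span S" using F_dim by blast
    ultimately show ?thesis
      by (intro ring_dim_eq_dim[of _ S]) (auto simp: growth_space_alg)
  qed
  have upper: "limsup (\<lambda>n. ereal (g (span B) n)) \<le> ereal (real d)" if B: "finite B" for B
  proof -
    obtain m where m: "m > 0" "\<And>n. growth_space alg (span B) n \<subseteq> F (m * n)"
      using growth_bound[OF B] by blast
    \<comment> \<open>\<open>m n + 1 \<le> 2 m n\<close> yields the factor \<open>(2 m)\<^sup>d\<close>; the successor keeps \<open>K\<close> positive when \<open>C = 0\<close>\<close>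
    define K where "K = real (Suc C * (2 * m) ^ d)"
    have "K > 0" using m(1) unfolding K_def of_nat_0_less_iff by simp
    have "\<forall>\<^sub>F n in sequentially. ereal (g (span B) n) \<le> ereal (log (real n) (K * real n ^ d))"
      using eventually_gt_at_top[of 1]
    proof eventually_elim
      case (elim n)
      obtain S where S: "finite S" "F (m * n) \<subseteq> span S" "card S \<le> C * (m * n + 1) ^ d"
        using F_dim by blast
      let ?D = "dim (growth_space alg (span B) n)"
      have "?D \<le> card S"
        using m(2)[of n] S by (intro dim_le_card) auto
      also have "card S \<le> Suc C * (2 * m * n) ^ d"
      proof -
        have "m * n + 1 \<le> 2 * m * n" using m(1) elim by (cases "m * n") auto
        then have "(m * n + 1) ^ d \<le> (2 * m * n) ^ d"
          by (rule power_mono) simp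
        then show ?thesis
          using S(3) by (meson le_SucI le_refl mult_le_mono order_trans)
      qed
      finally have D: "real ?D \<le> K * real n ^ d"
        unfolding K_def power_mult_distrib of_nat_mult[symmetric] of_nat_power[symmetric]
        by (simp only: of_nat_le_iff mult.assoc)
      have "1 \<le> ?D"
      proof -
        have "{\<e>} \<subseteq> growth_space alg (span B) n"
          unfolding growth_space_alg by (auto intro!: span_base exI[of _ "[]"])
        moreover have "independent {\<e>}"
          by (simp add: one_neq_zero)
        ultimately have "card {\<e>} \<le> ?D"
          using m(2)[of n] S by (intro card_le_dim[of _ _ S]) auto
        then show ?thesis by simp
      qed
      then have "log (real n) (real ?D) \<le> log (real n) (K * real n ^ d)"
        using elim D by (subst log_le_cancel_iff) auto
      then show ?case
        by (simp add: g_def dim_growth[OF B])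
    qed
    then have "limsup (\<lambda>n. ereal (g (span B) n)) \<le> limsup (\<lambda>n. ereal (log (real n) (K * real n ^ d)))"
      by (rule Limsup_mono)
    also have "\<dots> = ereal (real d)"
      using log_monomial_tendsto[OF \<open>K > 0\<close>] by (intro lim_imp_Limsup) simp
    finally show ?thesis .
  qed
  have lower: "ereal (real d) \<le> limsup (\<lambda>n. ereal (g (span V) n))"
  proof -
    have "\<forall>\<^sub>F n in sequentially. ereal (log (real n) (k * real n ^ d)) \<le> ereal (g (span V) n)"
      using eventually_gt_at_top[of 1]
    proof eventually_elim
      case (elim n)
      let ?G = "growth_space alg (span V) n"
      obtain B where B: "independent B" "B \<subseteq> {foldr (\<star>) vs \<e> | vs. set vs \<subseteq> V \<and> length vs \<le> n}"
        "k * real n ^ d \<le> real (card B)"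
        using lower by blast
      have "B \<subseteq> ?G"
      proof
        fix b assume "b \<in> B"
        then obtain vs where vs: "b = foldr (\<star>) vs \<e>" "set vs \<subseteq> V" "length vs \<le> n"
          using B(2) by blast
        moreover have "set vs \<subseteq> span V"
          using vs(2) span_superset[of V] by blast
        ultimately show "b \<in> ?G"
          unfolding growth_space_alg by (intro span_base) blast
      qed
      moreover obtain m where "?G \<subseteq> F (m * n)" using growth_bound[OF V] by blast
      moreover obtain S where "finite S" "F (m * n) \<subseteq> span S" using F_dim by blast
      ultimately have "card B \<le> dim ?G"
        using B(1) by (intro card_le_dim[of _ _ S]) auto
      then have "k * real n ^ d \<le> real (dim ?G)"
        using B(3) by linarith
      moreover have "0 < k * real n ^ d"
        using k elim by simp
      ultimately have "log (real n) (k * real n ^ d) \<le> log (real n) (real (dim ?G))"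
        using elim by (subst log_le_cancel_iff) auto
      then show ?case
        by (simp add: g_def dim_growth[OF V])
    qed
    then have "limsup (\<lambda>n. ereal (log (real n) (k * real n ^ d))) \<le> limsup (\<lambda>n. ereal (g (span V) n))"
      by (rule Limsup_mono)
    moreover have "limsup (\<lambda>n. ereal (log (real n) (k * real n ^ d))) = ereal (real d)"
      using log_monomial_tendsto[OF k] by (intro lim_imp_Limsup) simp
    ultimately show ?thesis by simp
  qed
  show ?thesis
    unfolding GKdim_def g_def[symmetric]
  proof (rule antisym)
    show "(SUP U \<in> {U. submodule U (ground :: 'k ring) alg \<and> ring.finite_dimension alg (scalars alg) U}.
        limsup (\<lambda>n. ereal (g U n))) \<le> ereal (real d)"
    proof (rule SUP_least)
      fix U assume "U \<in> {U. submodule U (ground :: 'k ring) alg \<and> ring.finite_dimension alg (scalars alg) U}"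
      then obtain B where "finite B" "U = span B"
        using finite_dimension_span by blast
      then show "limsup (\<lambda>n. ereal (g U n)) \<le> ereal (real d)"
        using upper by simp
    qed
    show "ereal (real d) \<le> (SUP U \<in> {U. submodule U (ground :: 'k ring) alg \<and> ring.finite_dimension alg (scalars alg) U}.
        limsup (\<lambda>n. ereal (g U n)))"
      using lower
      by (rule SUP_upper2[rotated]) (simp add: submodule_iff_subspace finite_dimension_spanI[OF V])
  qed
qed

end

section \<open>Growth of Laurent Ore extensions\<close>

text \<open>The bound is on absolute values of exponents, so that only finitely many monomials satisfy it and the
  substitution of \<open>x\<^sup>-\<^sup>1\<close> for \<open>x\<close> preserves it. It is an integer: a negative bound forces \<open>b = 0\<close>.\<close>

definition degree_bounded :: "int \<Rightarrow> 'k::zero laurent \<Rightarrow> bool"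
  where "degree_bounded n b \<longleftrightarrow> (\<forall>i. Poly_Mapping.lookup b i \<noteq> 0 \<longrightarrow> \<bar>i\<bar> \<le> n)"

lemma degree_bounded_0 [simp]: "degree_bounded n 0"
  by (simp add: degree_bounded_def)

lemma degree_bounded_mono: "degree_bounded n b \<Longrightarrow> n \<le> m \<Longrightarrow> degree_bounded m b"
  by (force simp: degree_bounded_def)

lemma degree_bounded_add:
  "degree_bounded n a \<Longrightarrow> degree_bounded n b \<Longrightarrow> degree_bounded n (a + b :: 'k::field laurent)"
  unfolding degree_bounded_def lookup_add by (metis add.right_neutral)

lemma degree_bounded_single: "\<bar>i\<bar> \<le> n \<Longrightarrow> degree_bounded n (Poly_Mapping.single i c)"
  by (simp add: degree_bounded_def lookup_single when_def)

lemma degree_bounded_exists: "\<exists>n. degree_bounded n (b :: 'k::field laurent)"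
proof (induction b rule: laurent_induct)
  case (1 i c)
  show ?case by (intro exI[of _ "\<bar>i\<bar>"]) (simp add: degree_bounded_single)
next
  case (2 a b)
  then obtain m m' where "degree_bounded m a" "degree_bounded m' b" by blast
  then show ?case
    by (intro exI[of _ "max m m'"]) (auto intro!: degree_bounded_add elim: degree_bounded_mono)
qed

lemma degree_bounded_mult:
  assumes "degree_bounded n a" "degree_bounded m b"
  shows "degree_bounded (n + m) (a * b :: 'k::field laurent)"
  unfolding degree_bounded_def
proof (intro allI impI)
  fix i assume "Poly_Mapping.lookup (a * b) i \<noteq> 0"
  then obtain j k where "i = j + k" "j \<in> Poly_Mapping.keys a" "k \<in> Poly_Mapping.keys b"
    using keys_mult[of a b] by (auto simp: in_keys_iff)
  then show "\<bar>i\<bar> \<le> n + m"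
    using assms unfolding degree_bounded_def in_keys_iff by (smt (verit))
qed

lemma degree_bounded_lin_ext:
  assumes "degree_bounded n b" and "\<And>i. \<bar>i\<bar> \<le> n \<Longrightarrow> degree_bounded m (T i)"
  shows "degree_bounded m (lin_ext T (b :: 'k::field laurent))"
proof -
  have sum: "degree_bounded m (\<Sum>i\<in>S. U i)" if "\<And>i. i \<in> S \<Longrightarrow> degree_bounded m (U i)"
    for S and U :: "int \<Rightarrow> 'k laurent"
    using that by (induction S rule: infinite_finite_induct) (simp_all add: degree_bounded_add)
  show ?thesis
    unfolding lin_ext_def
  proof (rule sum)
    fix i assume "i \<in> Poly_Mapping.keys b"
    then have "\<bar>i\<bar> \<le> n"
      using assms(1) by (simp add: degree_bounded_def in_keys_iff)
    then have "degree_bounded (0 + m) (lconst (Poly_Mapping.lookup b i) * T i)"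
      by (intro degree_bounded_mult assms(2)) (simp_all add: lconst_def degree_bounded_single)
    then show "degree_bounded m (lconst (Poly_Mapping.lookup b i) * T i)"
      by simp
  qed
qed

text \<open>Giving \<open>y\<close> the weight \<open>w\<close> makes the relation \<open>y b = \<sigma>(b) y + \<delta>(b)\<close> compatible with degrees; a positive
  weight leaves only finitely many monomials below any bound.\<close>

locale bounded_ore = laurent_ore \<sigma> \<delta>
  for \<sigma> \<delta> :: "'k::field_char_0 laurent \<Rightarrow> 'k laurent" +
  fixes w :: int
  assumes weight_pos: "w \<ge> 1"
    and degree_\<sigma>: "degree_bounded n b \<Longrightarrow> degree_bounded n (\<sigma> b)"
    and degree_\<delta>: "degree_bounded n b \<Longrightarrow> degree_bounded (n + w) (\<delta> b)"
begin

definition filtration :: "int \<Rightarrow> 'k laurent poly set"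
  where "filtration n = {f. \<forall>j. degree_bounded (n - w * int j) (Polynomial.coeff f j)}"

lemma filtration_add: "f \<in> filtration n \<Longrightarrow> h \<in> filtration n \<Longrightarrow> f + h \<in> filtration n"
  by (simp add: filtration_def degree_bounded_add)

lemma filtration_smult:
  assumes "degree_bounded n b" "f \<in> filtration m"
  shows "Polynomial.smult b f \<in> filtration (n + m)"
  using assms degree_bounded_mult[of n b "m - w * int j" for j] by (simp add: filtration_def add_diff_eq)

lemma filtration_mono: "n \<le> m \<Longrightarrow> filtration n \<subseteq> filtration m"
  using degree_bounded_mono[of "n - w * int j" _ "m - w * int j" for j] by (auto simp: filtration_def)

lemma subspace_filtration: "subspace (filtration n)"
proof (rule subspaceI)
  show "Polynomial.smult (lconst c) f \<in> filtration n" if "f \<in> filtration n" for c f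
    using filtration_smult[of 0 "lconst c", OF _ that] by (simp add: lconst_def degree_bounded_single)
qed (simp_all add: filtration_add, simp add: filtration_def)

lemma filtration_pCons:
  "pCons b f \<in> filtration n \<longleftrightarrow> degree_bounded n b \<and> f \<in> filtration (n - w)"
proof -
  have all: "(\<forall>j. P j) \<longleftrightarrow> P 0 \<and> (\<forall>j. P (Suc j))" for P
    by (metis nat.exhaust)
  show ?thesis
    unfolding filtration_def mem_Collect_eq all[of "\<lambda>j. degree_bounded (n - w * int j) (Polynomial.coeff (pCons b f) j)"]
    by (simp add: algebra_simps)
qed

lemma filtration_0 [simp]: "0 \<in> filtration n"
  by (simp add: filtration_def)

lemma filtration_y_times: "f \<in> filtration n \<Longrightarrow> ore_y_times \<sigma> \<delta> f \<in> filtration (n + w)"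
proof (induction f arbitrary: n)
  case (pCons b f)
  then have b: "degree_bounded n b" and f: "f \<in> filtration (n - w)"
    by (simp_all add: filtration_pCons)
  have "[:\<sigma> b:] \<in> filtration n" "ore_y_times \<sigma> \<delta> f \<in> filtration n"
    using degree_\<sigma>[OF b] pCons.IH[OF f] by (simp_all add: filtration_pCons)
  then have "[:\<sigma> b:] + ore_y_times \<sigma> \<delta> f \<in> filtration n"
    by (rule filtration_add)
  then show ?case
    using degree_\<delta>[OF b] by (simp add: y_times_pCons filtration_pCons[of "\<delta> b"])
qed simp

lemma filtration_mult:
  "f \<in> filtration n \<Longrightarrow> h \<in> filtration m \<Longrightarrow> f \<star> h \<in> filtration (n + m)"
proof (induction f arbitrary: h n m)
  case (pCons b f)
  then have b: "degree_bounded n b" and f: "f \<in> filtration (n - w)"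
    by (simp_all add: filtration_pCons)
  show ?case
    using filtration_smult[OF b pCons.prems(2)] pCons.IH[OF f filtration_y_times[OF pCons.prems(2)]]
    by (simp add: mult_pCons_left filtration_add)
qed simp

lemma filtration_exhaust: "\<exists>n. f \<in> filtration (int n)"
proof (induction f)
  case (pCons b f)
  then obtain n where n: "f \<in> filtration (int n)" by blast
  obtain m where m: "degree_bounded (int m) b"
  proof -
    obtain m where "degree_bounded m b" using degree_bounded_exists by blast
    then have "degree_bounded (int (nat m)) b" by (rule degree_bounded_mono) simp
    then show thesis by (rule that)
  qed
  have "pCons b f \<in> filtration (int (m + n + nat w))"
    unfolding filtration_pCons
    using degree_bounded_mono[OF m, of "int (m + n + nat w)"] filtration_mono[of "int n" "int (m + n + nat w) - w"] n
      weight_pos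
    by auto
  then show ?case by blast
qed simp

lemma lookup_lconst_mult: "Poly_Mapping.lookup (lconst c * b) i = c * Poly_Mapping.lookup b i"
  for b :: "'k laurent"
  by (induction b rule: laurent_induct)
    (simp_all add: lconst_def mult_single distrib_left lookup_add lookup_single when_def)

lemma monom_in_span:
  assumes "degree_bounded (int n) b"
  shows "monom b j \<in> span ((\<lambda>i. monom (lX i) j) ` {- int n..int n})"
proof -
  have "lin_ext lX b = b"
    by (induction b rule: laurent_induct) (simp_all add: lin_ext_add lin_ext_single lconst_lX)
  then have "monom b j = monom (\<Sum>i\<in>Poly_Mapping.keys b. lconst (Poly_Mapping.lookup b i) * lX i) j"
    by (simp add: lin_ext_def)
  also have "\<dots> = (\<Sum>i\<in>Poly_Mapping.keys b. Polynomial.smult (lconst (Poly_Mapping.lookup b i)) (monom (lX i) j))"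
    by (rule poly_eqI) (simp add: coeff_sum smult_monom)
  also have "\<dots> \<in> span ((\<lambda>i. monom (lX i) j) ` {- int n..int n})"
    using assms by (intro span_sum span_scale span_base imageI) (simp add: degree_bounded_def in_keys_iff abs_le_iff minus_le_iff)
  finally show ?thesis .
qed

lemma filtration_dim:
  "\<exists>S. finite S \<and> filtration (int n) \<subseteq> span S \<and> card S \<le> 2 * (n + 1) ^ 2"
proof -
  define S :: "'k laurent poly set" where "S = (\<lambda>(i, j). monom (lX i) j) ` ({- int n..int n} \<times> {..n})"
  have "filtration (int n) \<subseteq> span S"
  proof
    fix f assume f: "f \<in> filtration (int n)"
    have "monom (Polynomial.coeff f j) j \<in> span S" for j
    proof (cases "Polynomial.coeff f j = 0")
      case False
      have bound: "degree_bounded (int n - w * int j) (Polynomial.coeff f j)"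
        using f by (simp add: filtration_def)
      obtain i where "Poly_Mapping.lookup (Polynomial.coeff f j) i \<noteq> 0"
        using False by (metis lookup_zero poly_mapping_eqI)
      with bound have "w * int j \<le> int n"
        unfolding degree_bounded_def by (smt (verit))
      moreover have "1 * int j \<le> w * int j"
        using weight_pos by (intro mult_right_mono) auto
      ultimately have "j \<le> n" by linarith
      have "w * int j \<ge> 0" using weight_pos by simp
      then have "monom (Polynomial.coeff f j) j \<in> span ((\<lambda>i. monom (lX i) j) ` {- int n..int n})"
        by (intro monom_in_span degree_bounded_mono[OF bound]) simp
      also have "\<dots> \<subseteq> span S"
        using \<open>j \<le> n\<close> by (intro span_mono) (auto simp: S_def)
      finally show ?thesis .
    qed (simp add: span_zero)
    then have "(\<Sum>j\<le>Polynomial.degree f. monom (Polynomial.coeff f j) j) \<in> span S"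
      by (intro span_sum)
    then show "f \<in> span S"
      by (simp add: poly_as_sum_of_monoms)
  qed
  moreover have "card S \<le> 2 * (n + 1) ^ 2"
  proof -
    have "card S \<le> card ({- int n..int n} \<times> {..n})"
      unfolding S_def by (rule card_image_le) simp
    also have "card {- int n..int n} = 2 * n + 1"
      unfolding card_atLeastAtMost_int by linarith
    then have "card ({- int n..int n} \<times> {..n}) = (2 * n + 1) * (n + 1)"
      by (simp add: card_cartesian_product)
    also have "\<dots> \<le> 2 * (n + 1) ^ 2"
      by (simp add: power2_eq_square)
    finally show ?thesis .
  qed
  ultimately show ?thesis
    by (intro exI[of _ S]) (simp add: S_def)
qed

lemma lookup_coeff_monom:
  "Poly_Mapping.lookup (Polynomial.coeff (monom (lX i) j :: 'k laurent poly) j') i' = (if i = i' \<and> j = j' then 1 else 0)"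
  by (simp add: lX_def lookup_single when_def)

lemma monoms_independent:
  assumes "finite I"
  shows "independent ((\<lambda>(i, j). monom (lX i) j) ` I)" "card ((\<lambda>(i, j). monom (lX i) j :: 'k laurent poly) ` I) = card I"
proof -
  have eq: "i = i' \<and> j = j'" if "monom (lX i :: 'k laurent) j = monom (lX i') j'" for i i' j j'
    using lookup_coeff_monom[of i j j i] lookup_coeff_monom[of i' j' j i] that by (auto split: if_splits)
  then show "card ((\<lambda>(i, j). monom (lX i) j :: 'k laurent poly) ` I) = card I"
    by (intro card_image) (auto simp: inj_on_def)
  show "independent ((\<lambda>(i, j). monom (lX i) j) ` I)"
  proof (rule independent_if_scalars_zero)
    fix u and f :: "'k laurent poly"
    let ?B = "(\<lambda>(i, j). monom (lX i) j :: 'k laurent poly) ` I"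
    assume sum: "(\<Sum>f\<in>?B. Polynomial.smult (lconst (u f)) f) = 0" and f: "f \<in> ?B"
    obtain i j where ij: "f = monom (lX i) j" using f by auto
    have "0 = (\<Sum>h\<in>?B. u h * Poly_Mapping.lookup (Polynomial.coeff h j) i)"
      using arg_cong[OF sum, of "\<lambda>h. Poly_Mapping.lookup (Polynomial.coeff h j) i"]
      by (simp add: coeff_sum lookup_sum lookup_lconst_mult)
    also have "\<dots> = (\<Sum>h\<in>?B. if h = f then u h else 0)"
    proof (rule sum.cong)
      fix h assume "h \<in> ?B"
      then obtain i' j' where h: "h = monom (lX i') j'" by auto
      show "u h * Poly_Mapping.lookup (Polynomial.coeff h j) i = (if h = f then u h else 0)"
        unfolding h ij lookup_coeff_monom using eq[of i' j' i j] by auto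
    qed simp
    also have "\<dots> = u f"
      using f assms by (simp add: sum.delta)
    finally show "u f = 0" by simp
  qed (use assms in simp)
qed

text \<open>The monomial \<open>x\<^sup>i y\<^sup>j\<close> is a word of length \<open>i + j\<close> in \<open>x\<close> and \<open>y\<close>.\<close>

lemma monom_eq_word:
  "monom (lX (int i)) j = foldr (\<star>) (replicate i [:lX 1:] @ replicate j y) 1"
proof -
  have "y \<star> monom 1 j = monom 1 (Suc j)" for j
    by (induction j) (simp_all add: monom_Suc mult_shift_right monom_0 mult_y_left y_times_pCons)
  then have "foldr (\<star>) (replicate j y) 1 = monom 1 j"
    by (induction j) (simp_all add: monom_0 one_pCons)
  moreover have "foldr (\<star>) (replicate i [:lX 1:]) f = Polynomial.smult (lX (int i)) f" for f
    by (induction i) (simp_all add: lX_0 lX_mult)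
  ultimately show ?thesis
    by (simp add: smult_monom)
qed

lemma GKdim_bounded_ore: "GKdim alg = 2"
proof -
  have "GKdim alg = ereal (real 2)"
  proof (rule GKdim_eqI[where F = "\<lambda>n. filtration (int n)" and C = 2 and V = "{[:lX 1:], y}" and k = "1 / 4"])
    show "1 \<in> filtration (int 0)"
      by (simp add: one_pCons filtration_pCons) (simp add: degree_bounded_def lookup_one when_def)
    show "f \<star> h \<in> filtration (int (n + m))" if "f \<in> filtration (int n)" "h \<in> filtration (int m)" for n m f h
      using filtration_mult[OF that] by simp
    show "\<exists>B. independent B \<and> B \<subseteq> {foldr (\<star>) vs 1 | vs. set vs \<subseteq> {[:lX 1:], y} \<and> length vs \<le> n} \<and>
        1 / 4 * real n ^ 2 \<le> real (card B)" for n
    proof -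
      \<comment> \<open>exponents up to \<open>n / 2\<close> keep the words within length \<open>n\<close> and give about \<open>n\<^sup>2 / 4\<close> of them\<close>
      define m where "m = n div 2"
      define I where "I = int ` {..m} \<times> {..m}"
      let ?B = "(\<lambda>(i, j). monom (lX i) j :: 'k laurent poly) ` I"
      have "finite I" by (simp add: I_def)
      have "?B \<subseteq> {foldr (\<star>) vs 1 | vs. set vs \<subseteq> {[:lX 1:], y} \<and> length vs \<le> n}"
      proof
        fix f assume "f \<in> ?B"
        then obtain i j where "i \<le> m" "j \<le> m" and f: "f = monom (lX (int i)) j"
          by (auto simp: I_def)
        then have "i + j \<le> n" by (simp add: m_def)
        then show "f \<in> {foldr (\<star>) vs 1 | vs. set vs \<subseteq> {[:lX 1:], y} \<and> length vs \<le> n}"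
          unfolding f monom_eq_word
          by (intro CollectI exI[of _ "replicate i [:lX 1:] @ replicate j y"]) auto
      qed
      moreover have "1 / 4 * real n ^ 2 \<le> real (card ?B)"
      proof -
        have "card I = (m + 1) ^ 2"
          by (simp add: I_def card_cartesian_product card_image power2_eq_square)
        moreover have "(real n / 2) ^ 2 \<le> (real m + 1) ^ 2"
          by (rule power_mono) (auto simp: m_def)
        ultimately show ?thesis
          unfolding monoms_independent(2)[OF \<open>finite I\<close>] by (simp add: power_divide add.commute)
      qed
      ultimately show ?thesis
        using monoms_independent(1)[OF \<open>finite I\<close>] by blast
    qed
    show "\<exists>S. finite S \<and> filtration (int n) \<subseteq> span S \<and> card S \<le> 2 * (n + 1) ^ 2" for n
      by (rule filtration_dim)
  qed (simp_all add: subspace_filtration filtration_mono filtration_exhaust)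
  then show ?thesis by simp
qed

lemma affine_ore: "affine_algebra alg"
proof -
  let ?S = "{[:lX 1:], [:lX (- 1):], y} :: 'k laurent poly set"
  have add: "f + h \<in> alg_generate alg ?S" and mult: "f \<star> h \<in> alg_generate alg ?S"
    if "f \<in> alg_generate alg ?S" "h \<in> alg_generate alg ?S" for f h
    using that generate_ring.eng_add[of f alg _ h] generate_ring.eng_mult[of f alg _ h]
    by (simp_all add: alg_generate_def)
  have gen: "f \<in> alg_generate alg ?S" if "f \<in> ?S" for f
    using that by (auto simp: alg_generate_def intro: generate_ring.incl)
  have scalar: "[:lconst c:] \<in> alg_generate alg ?S" for c
    unfolding alg_generate_def scalars_def by (intro generate_ring.incl) auto
  have power: "[:lX (int n * e):] \<in> alg_generate alg ?S" if "[:lX e:] \<in> ?S" for n e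
  proof (induction n)
    case 0
    show ?case using scalar[of 1] by (simp add: lX_0)
  next
    case (Suc n)
    from mult[OF gen[OF that] this] show ?case
      by (simp add: lX_mult algebra_simps)
  qed
  have lX: "[:lX i:] \<in> alg_generate alg ?S" for i
    using power[of 1 "nat i"] power[of "- 1" "nat (- i)"] by (cases "i \<ge> 0") auto
  have const: "[:b:] \<in> alg_generate alg ?S" for b
  proof (induction b rule: laurent_induct)
    case (1 i c)
    from mult[OF scalar[of c] lX[of i]] show ?case by (simp add: lconst_lX)
  next
    case (2 a b)
    from add[OF this] show ?case by simp
  qed
  have "f \<in> alg_generate alg ?S" for f
  proof (induction f)
    case 0
    show ?case using const[of 0] by simp
  next
    case (pCons b f)
    have "[:b:] + f \<star> y \<in> alg_generate alg ?S"
      by (rule add[OF const mult[OF pCons(2) gen]]) simp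
    then show ?case by (simp add: mult_y_right)
  qed
  then show ?thesis
    unfolding affine_algebra_def using assoc_algebra_alg by (intro conjI exI[of _ ?S]) auto
qed

end

locale smooth_ore = twisted_ore \<sigma> \<delta> \<epsilon> g + bounded_ore \<sigma> \<delta> w
  for \<sigma> \<delta> :: "'k::field_char_0 laurent \<Rightarrow> 'k laurent" and \<epsilon> g w
begin

lemma differentially_smooth_ore: "differentially_smooth (ore_algebra \<sigma> \<delta>)"
  using affine_ore GKdim_bounded_ore integrable_calculus
  unfolding differentially_smooth_def alg_eq
  by (intro conjI exI[of _ 2]) simp_all

end

section \<open>The three families\<close>

lemma sigma_q_single: "sigma_q q e (Poly_Mapping.single i c) = Poly_Mapping.single (e * i) (c * q powi i)"
  by (simp add: sigma_q_lin_ext lin_ext_single lconst_lX) (simp add: lconst_def mult_single)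

lemma sigma_q_add: "sigma_q q e (a + b) = sigma_q q e a + sigma_q q e b"
  by (simp add: sigma_q_lin_ext lin_ext_add)

lemma sigma_q_diff: "sigma_q q e (a - b) = sigma_q q e a - sigma_q q e b"
  using sigma_q_add[of q e "a - b" b] by simp

lemma sigma_q_lconst [simp]: "sigma_q q e (lconst c) = lconst c"
  by (simp add: lconst_def sigma_q_single)

text \<open>The inverse of \<open>x \<mapsto> q x\<^sup>e\<close> is \<open>x \<mapsto> q\<^sup>-\<^sup>e x\<^sup>e\<close>, as \<open>e = \<plusminus>1\<close>.\<close>

lemma sigma_q_inverse:
  assumes "q \<noteq> 0" "e * e = 1"
  shows "sigma_q (q powi - e) e (sigma_q q e b) = b"
proof (induction b rule: laurent_induct)
  case (1 i c)
  have "- e * (e * i) = - i" "e * (e * i) = i"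
    using assms(2) by (simp_all add: mult.assoc[symmetric])
  then have "(q powi - e) powi (e * i) = q powi - i" "e * (e * i) = i"
    by (simp_all only: power_int_mult[symmetric])
  then show ?case
    using assms(1) by (simp only: sigma_q_single) (simp add: power_int_minus mult.assoc)
qed (simp add: sigma_q_add)

lemma sigma_q_inverse':
  assumes "q \<noteq> 0" "e * e = 1"
  shows "sigma_q q e (sigma_q (q powi - e) e b) = b"
proof -
  have "- e * - e = 1" using assms(2) by simp
  then have "(q powi - e) powi - e = q"
    by (simp only: power_int_mult[symmetric]) simp
  then show ?thesis
    using sigma_q_inverse[of "q powi - e" e b] assms by simp
qed

lemma bij_sigma_q:
  assumes "q \<noteq> 0" "e * e = 1"
  shows "bij (sigma_q q e)"
  by (rule bij_betw_byWitness[where f' = "sigma_q (q powi - e) e"])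
    (simp_all add: sigma_q_inverse sigma_q_inverse' assms)

lemma euler_sigma_q: "euler (sigma_q q e b) = lconst (of_int e) * sigma_q q e (euler b)"
proof (induction b rule: laurent_induct)
  case (1 i c)
  show ?case by (simp only: sigma_q_single euler_single lconst_def mult_single add_0 of_int_mult mult_ac)
qed (simp add: sigma_q_add euler_add distrib_left)

lemma degree_bounded_sigma_q:
  assumes "e * e = 1" "degree_bounded n b"
  shows "degree_bounded n (sigma_q q e b)"
proof -
  have "\<bar>e\<bar> = 1"
    using assms(1) by (simp add: zmult_eq_1_iff) auto
  then show ?thesis
    unfolding sigma_q_lin_ext lconst_lX
    by (intro degree_bounded_lin_ext[OF assms(2)] degree_bounded_single) (simp add: abs_mult)
qed

lemma delta_p_eqI:
  assumes "q \<noteq> 0" "sigma_derivation (sigma_q q e) \<delta>" "\<delta> (lX 1) = p"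
  shows "delta_p q e p = \<delta>"
  using sigma_derivation_unique[OF assms(1) delta_p(1)[OF assms(1)] assms(2)] delta_p(2)[OF assms(1)] assms(3)
  by metis

text \<open>Since \<open>\<sigma>\<close> is the identity, \<open>\<epsilon> = 1\<close>. Applying a \<open>\<rho>\<close>-derivation that extends \<open>D\<close> and kills \<open>y\<close>
  to \<open>y b = b y + f D b\<close> forces \<open>\<rho>(y) = y - D f\<close>, because \<open>D(f D b) - f D(D b) = (D f)(D b)\<close>. The
  weight of \<open>y\<close> is a bound for the degree of \<open>f\<close>.\<close>

lemma smooth_derivation:
  fixes f :: "'k::field_char_0 laurent"
  shows "differentially_smooth (ore_algebra (sigma_q 1 1) (\<lambda>b. f * euler b))"
    and "sigma_derivation (sigma_q 1 1) (\<lambda>b. f * euler b)"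
proof -
  have id: "sigma_q 1 1 b = b" for b :: "'k laurent"
    by (induction b rule: laurent_induct) (simp_all add: sigma_q_single sigma_q_add)
  show "sigma_derivation (sigma_q 1 1) (\<lambda>b. f * euler b)"
    unfolding sigma_derivation_def id by (auto simp: euler_add euler_mult algebra_simps)
  obtain m where m: "degree_bounded m f" using degree_bounded_exists by blast
  have "smooth_ore (sigma_q 1 1) (\<lambda>b. f * euler b) 1 (- euler f) (max 1 m)"
  proof
    show "degree_bounded (n + max 1 m) (f * euler b)" if "degree_bounded n b" for n and b :: "'k laurent"
    proof -
      have "degree_bounded n (euler b)"
        unfolding degree_bounded_def lookup_euler using that by (auto simp: degree_bounded_def)
      from degree_bounded_mult[OF m this] show ?thesis
        by (rule degree_bounded_mono) simp
    qed
  qed (simp_all add: id bij_sigma_q euler_add euler_mult algebra_simps fun_eq_iff)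
  then show "differentially_smooth (ore_algebra (sigma_q 1 1) (\<lambda>b. f * euler b))"
    by (rule smooth_ore.differentially_smooth_ore)
qed

text \<open>The element \<open>z = y - c\<close> satisfies \<open>z b = \<sigma>(b) z\<close>, and \<open>\<rho>(z) = \<epsilon> z\<close> then reads
  \<open>\<rho>(y) = \<epsilon> y + (1 - \<epsilon>) c\<close>. Since \<open>\<delta>\<close> does not raise degrees, the weight \<open>1\<close> suffices for \<open>y\<close>.\<close>

lemma smooth_inner:
  fixes q c :: "'k::field_char_0"
  assumes "q \<noteq> 0" "e * e = 1"
  shows "differentially_smooth (ore_algebra (sigma_q q e) (\<lambda>b. lconst c * (b - sigma_q q e b)))"
    and "sigma_derivation (sigma_q q e) (\<lambda>b. lconst c * (b - sigma_q q e b))"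
proof -
  note sigma_mult = sigma_q_mult[OF assms(1), of e]
  have sigma_1: "sigma_q q e 1 = 1"
    using sigma_q_lconst[of q e 1] by simp
  show "sigma_derivation (sigma_q q e) (\<lambda>b. lconst c * (b - sigma_q q e b))"
    unfolding sigma_derivation_def
    by (auto simp: sigma_q_add sigma_mult algebra_simps)
  have e: "of_int e * of_int e = (1 :: 'k)"
    using assms(2) by (metis of_int_1 of_int_mult)
  have lin: "euler (lconst k * b) = lconst k * euler b" for k and b :: "'k laurent"
    by (simp add: euler_mult)
  have "smooth_ore (sigma_q q e) (\<lambda>b. lconst c * (b - sigma_q q e b)) (of_int e) (lconst ((1 - of_int e) * c)) 1"
  proof
    show "(1 - lconst (of_int e)) * (lconst c * (b - sigma_q q e b)) =
        lconst ((1 - of_int e) * c) * (b - sigma_q q e b)" for b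
      by (simp add: lconst_mult lconst_diff algebra_simps)
    show "lconst c * (euler b - sigma_q q e (euler b)) =
        lconst ((1 - of_int e) * c) * euler (sigma_q q e b) + euler (lconst c * (b - sigma_q q e b))" for b
    proof -
      have "lconst (of_int e) * (lconst (of_int e) * a) = a" for a :: "'k laurent"
        by (simp add: mult.assoc[symmetric] lconst_mult[symmetric] e)
      then show ?thesis
        unfolding lin euler_diff euler_sigma_q lconst_mult lconst_diff by (simp add: algebra_simps)
    qed
    show "degree_bounded (n + 1) (lconst c * (b - sigma_q q e b))" if "degree_bounded n b" for n b
    proof -
      have "degree_bounded n (lconst (- 1) * sigma_q q e b)"
        using degree_bounded_mult[of 0 "lconst (- 1)" n "sigma_q q e b"] degree_bounded_sigma_q[OF assms(2) that]
        by (simp add: lconst_def degree_bounded_single)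
      then have "degree_bounded n (b + lconst (- 1) * sigma_q q e b)"
        by (rule degree_bounded_add[OF that])
      moreover have "b + lconst (- 1) * sigma_q q e b = b - sigma_q q e b"
        using lconst_diff[of 0 "1 :: 'k"] by simp
      ultimately have "degree_bounded (1 + n) (lconst c * (b - sigma_q q e b))"
        by (intro degree_bounded_mult) (simp_all add: lconst_def degree_bounded_single)
      then show ?thesis by (simp add: add.commute)
    qed
  qed (simp_all add: sigma_q_add sigma_mult sigma_1 sigma_q_diff bij_sigma_q assms e euler_sigma_q
      degree_bounded_sigma_q algebra_simps)
  then show "differentially_smooth (ore_algebra (sigma_q q e) (\<lambda>b. lconst c * (b - sigma_q q e b)))"
    by (rule smooth_ore.differentially_smooth_ore)
qed

theorem proposition3p7:
  fixes p :: "'k::{alg_closed_field, field_char_0} laurent"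
    and q c :: 'k
  shows "differentially_smooth (A_alg 1 1 p)
    \<and> (q \<noteq> 0 \<longrightarrow> differentially_smooth (A_alg q 1 (lconst c * lX 1)))
    \<and> (q \<noteq> 0 \<longrightarrow> differentially_smooth (A_alg q (- 1) (lconst c * (lX 1 - lconst q * lX (- 1)))))"
proof -
  have derivation: "differentially_smooth (A_alg 1 1 p)" for p :: "'k laurent"
  proof -
    have "delta_p 1 1 p = (\<lambda>b. p * lX (- 1) * euler b)"
      by (rule delta_p_eqI[OF _ smooth_derivation(2)]) (simp_all add: euler_lX mult.assoc lX_mult lX_0)
    then show ?thesis
      by (simp add: A_alg_def smooth_derivation(1))
  qed
  moreover have "differentially_smooth (A_alg q 1 (lconst c * lX 1))" if "q \<noteq> 0"
  proof (cases "q = 1")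
    case True
    then show ?thesis by (simp add: derivation)
  next
    case False
    \<comment> \<open>\<open>c x = c / (1 - q) \<cdot> (x - \<sigma>(x))\<close>, so that the derivation is inner\<close>
    have "lconst (c / (1 - q)) * (lX 1 - lconst q * lX 1) = lconst (c / (1 - q)) * (lconst 1 - lconst q) * lX 1"
      by (simp add: algebra_simps)
    also have "lconst 1 - lconst q = lconst (1 - q)"
      by (rule lconst_diff[symmetric])
    also have "lconst (c / (1 - q)) * lconst (1 - q) = lconst c"
      using False by (simp add: lconst_mult[symmetric])
    finally have "delta_p q 1 (lconst c * lX 1) = (\<lambda>b. lconst (c / (1 - q)) * (b - sigma_q q 1 b))"
      using that by (intro delta_p_eqI smooth_inner(2)) (simp_all add: sigma_q_lX)
    then show ?thesis
      by (simp only: A_alg_def) (rule smooth_inner(1), use that in simp_all)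
  qed
  moreover have "differentially_smooth (A_alg q (- 1) (lconst c * (lX 1 - lconst q * lX (- 1))))" if "q \<noteq> 0"
  proof -
    have "delta_p q (- 1) (lconst c * (lX 1 - lconst q * lX (- 1))) =
        (\<lambda>b. lconst c * (b - sigma_q q (- 1) b))"
      using that by (intro delta_p_eqI smooth_inner(2)) (simp_all add: sigma_q_lX)
    then show ?thesis
      by (simp only: A_alg_def) (rule smooth_inner(1), use that in simp_all)
  qed
  ultimately show ?thesis by blast
qed

end
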